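(* Let $m,n\geq 1$ be integers and let $p,q>0$ be real numbers. Let $\mathcal{S}$ be the configuration space and $\tilde{H}:\mathcal{S}\to\mathbb{R}$ the Hamiltonian defined in the context. Then $\tilde{H}$ attains its maximum on $\mathcal{S}$ precisely at the configuration $(\{\phi_j\}_{j=1}^m,\{\psi_j\}_{j=1}^m,\{\theta_j\}_{j=1}^{2mn})\in\mathcal{S}$ for which the points $\{e^{i\phi_j}\}_{j=1}^m$ are the $m$-th roots of $1$, the points $\{e^{i\psi_j}\}_{j=1}^m$ are the $m$-th roots of $-1$, and the points $\{e^{i\theta_j}\}_{j=1}^{2mn}$ are the zeros of the polynomial (in $z$) $$z^{mn}P_n^{(p-1/2,\,q-1/2)}\left(\frac{z^m}{2}+\frac{1}{2z^m}\right).$$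
   Context: $P_n^{(\alpha,\beta)}(x)$ denotes the classical degree $n$ Jacobi polynomial (here $\alpha,\beta>-1$), which satisfies $$(1-x^2)y''+(\beta-\alpha-(\alpha+\beta+2)x)y'+n(n+\alpha+\beta+1)y=0.$$ The configuration space $\mathcal{S}$ is the set of all tuples of real numbers $(\{\phi_j\}_{j=1}^m,\{\psi_j\}_{j=1}^m,\{\theta_j\}_{j=1}^{2mn})$ such that $\phi_1=0$ and, with the convention $\phi_{m+1}=2\pi$, for each $j=1,\ldots,m$: $$\phi_j<\theta_{2(j-1)n+1}<\theta_{2(j-1)n+2}<\cdots<\theta_{(2j-1)n}<\psi_j,$$ $$\psi_j<\theta_{(2j-1)n+1}<\theta_{(2j-1)n+2}<\cdots<\theta_{2jn}<\phi_{j+1}.$$ The Hamiltonian $\tilde{H}$ on $\mathcal{S}$ is \begin{align*} \tilde{H}\left(\{\phi_j\}_{j=1}^m,\{\psi_j\}_{j=1}^m,\{\theta_j\}_{j=1}^{2mn}\right)&=p\sum_{j=1}^{m}\sum_{k=1}^{2mn}\log |e^{i\phi_j}-e^{i \theta_k}|+q\sum_{j=1}^{m}\sum_{k=1}^{2mn}\log |e^{i\psi_j}-e^{i \theta_k}|\\ &\quad+\sum_{1 \leq k<j\leq 2mn}\log |e^{i\theta_j}-e^{i\theta_k}|+p^2\sum_{1\leq k<j\leq m}\log |e^{i\phi_j}-e^{i \phi_k}|\\ &\quad+q^2\sum_{1 \leq k<j\leq m}\log |e^{i\psi_j}-e^{i\psi_k}|+pq\sum_{1\leq k,j\leq m}\log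 |e^{i\phi_j}-e^{i \psi_k}|. \end{align*} *)

theory Defs
  imports "HOL-Complex_Analysis.Complex_Analysis"
begin

text \<open>
  The Jacobi polynomial $P_n^{(\alpha,\beta)}$ in its classical normalisation
  $P_n^{(\alpha,\beta)}(1) = {n+\alpha \choose n}$, by the explicit formula (Szego, (4.3.2))
  $\sum_s {n+\alpha \choose n-s}{n+\beta \choose s}
    \left(\frac{x-1}{2}\right)^s \left(\frac{x+1}{2}\right)^{n-s}$.
\<close>

definition jacobi_poly :: "nat \<Rightarrow> real \<Rightarrow> real \<Rightarrow> real poly" where
  "jacobi_poly n \<alpha> \<beta> =
     (\<Sum>s\<le>n. smult (((real n + \<alpha>) gchoose (n - s)) * ((real n + \<beta>) gchoose s))
               ([:-1/2, 1/2:] ^ s * [:1/2, 1/2:] ^ (n - s)))"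

lemma degree_jacobi_poly_le: "degree (jacobi_poly n \<alpha> \<beta>) \<le> n"
  unfolding jacobi_poly_def
proof (intro degree_sum_le)
  fix s assume s: "s \<in> {..n}"
  have "degree ([:-1/2, 1/2::real:] ^ s * [:1/2, 1/2:] ^ (n - s)) \<le> s + (n - s)"
    by (rule order_trans[OF degree_mult_le add_mono]; rule order_trans[OF degree_power_le]) simp_all
  then show "degree (smult (((real n + \<alpha>) gchoose (n - s)) * ((real n + \<beta>) gchoose s))
               ([:-1/2, 1/2:] ^ s * [:1/2, 1/2:] ^ (n - s))) \<le> n"
    using s by (intro order_trans[OF degree_smult_le]) simp
qed simp

text \<open>
  The polynomial $z^{mn} P(z^m/2 + 1/(2z^m))$ in $z$, for $P$ of degree at most $n$. It is built
  as an element of the polynomial ring, since the literal expression, read as a function with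
  division by zero yielding zero, would have a spurious zero at $z = 0$.
\<close>

definition circle_poly :: "nat \<Rightarrow> nat \<Rightarrow> real poly \<Rightarrow> complex poly" where
  "circle_poly m n P =
     (\<Sum>k\<le>n. smult (complex_of_real (coeff P k))
               (monom 1 (m * (n - k)) * (monom (1/2) (2 * m) + [:1/2:]) ^ k))"

lemma poly_circle_poly:
  assumes "degree P \<le> n" "z \<noteq> 0"
  shows "poly (circle_poly m n P) z =
           z ^ (m * n) * poly (map_poly complex_of_real P) (z ^ m / 2 + 1 / (2 * z ^ m))"
proof -
  let ?w = "z ^ m / 2 + 1 / (2 * z ^ m)"
  have w: "z ^ (2 * m) / 2 + 1 / 2 = z ^ m * ?w"
  proof -
    have "z ^ (2 * m) = z ^ m * z ^ m"
      by (simp only: mult_2 power_add)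
    moreover have "z ^ m \<noteq> 0"
      using assms(2) by simp
    then have "1 / 2 = z ^ m * (1 / (2 * z ^ m))"
      by simp
    ultimately show ?thesis
      by (simp only: distrib_left times_divide_eq_right)
  qed
  have *: "z ^ (m * (n - k)) * (z ^ (2 * m) / 2 + 1 / 2) ^ k = z ^ (m * n) * ?w ^ k"
    if "k \<le> n" for k
  proof -
    have "m * n = m * (n - k + k)"
      using that by simp
    then have "m * n = m * (n - k) + m * k"
      by (simp only: distrib_left)
    then have "z ^ (m * n) = z ^ (m * (n - k)) * (z ^ m) ^ k"
      by (simp only: power_add power_mult)
    then show ?thesis
      by (simp only: w power_mult_distrib mult.assoc)
  qed
  have deg: "degree (map_poly complex_of_real P) \<le> n"
    using map_poly_degree_leq[of complex_of_real P] assms(1) by (rule order_trans)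
  have "poly (map_poly complex_of_real P) ?w = (\<Sum>k\<le>n. complex_of_real (coeff P k) * ?w ^ k)"
  proof -
    have "poly (map_poly complex_of_real P) ?w =
        (\<Sum>k\<le>degree (map_poly complex_of_real P). complex_of_real (coeff P k) * ?w ^ k)"
      by (subst poly_altdef) (simp only: coeff_map_poly of_real_0)
    also have "\<dots> = (\<Sum>k\<le>n. complex_of_real (coeff P k) * ?w ^ k)"
    proof (rule sum.mono_neutral_left)
      show "\<forall>k\<in>{..n} - {..degree (map_poly complex_of_real P)}.
          complex_of_real (coeff P k) * ?w ^ k = 0"
      proof
        fix k assume "k \<in> {..n} - {..degree (map_poly complex_of_real P)}"
        then have "coeff (map_poly complex_of_real P) k = 0"
          by (intro coeff_eq_0) simp
        then have "complex_of_real (coeff P k) = 0"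
          by (simp only: coeff_map_poly of_real_0)
        then show "complex_of_real (coeff P k) * ?w ^ k = 0"
          by (simp only: mult_zero_left)
      qed
    qed (use deg in auto)
    finally show ?thesis .
  qed
  moreover have "poly (circle_poly m n P) z =
      (\<Sum>k\<le>n. complex_of_real (coeff P k) *
         (z ^ (m * (n - k)) * (z ^ (2 * m) / 2 + 1 / 2) ^ k))"
    by (simp add: circle_poly_def poly_sum poly_monom)
  moreover have "\<dots> = (\<Sum>k\<le>n. complex_of_real (coeff P k) * (z ^ (m * n) * ?w ^ k))"
    by (rule sum.cong) (simp_all only: atMost_iff *)
  ultimately show ?thesis
    by (simp only: sum_distrib_left mult.left_commute[of "z ^ (m * n)"])
qed

type_synonym config = "(nat \<Rightarrow> real) \<times> (nat \<Rightarrow> real) \<times> (nat \<Rightarrow> real)"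

text \<open>
  Finite tuples are functions on $\{1,\ldots,N\}$ that are \<^const>\<open>undefined\<close> elsewhere, so that
  two configurations are equal iff they have the same entries.
\<close>

definition config_space :: "nat \<Rightarrow> nat \<Rightarrow> config set" where
  "config_space m n =
     {(\<phi>, \<psi>, \<theta>).
        \<phi> \<in> {1..m} \<rightarrow>\<^sub>E UNIV \<and> \<psi> \<in> {1..m} \<rightarrow>\<^sub>E UNIV \<and> \<theta> \<in> {1..2*m*n} \<rightarrow>\<^sub>E UNIV \<and>
        \<phi> 1 = 0 \<and>
        (\<forall>j\<in>{1..m}.
           \<phi> j < \<theta> (2*(j-1)*n + 1) \<and>
           (\<forall>i\<in>{1..<n}. \<theta> (2*(j-1)*n + i) < \<theta> (2*(j-1)*n + i + 1)) \<and>
           \<theta> ((2*j-1)*n) < \<psi> j \<and>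
           \<psi> j < \<theta> ((2*j-1)*n + 1) \<and>
           (\<forall>i\<in>{1..<n}. \<theta> ((2*j-1)*n + i) < \<theta> ((2*j-1)*n + i + 1)) \<and>
           \<theta> (2*j*n) < (if j = m then 2 * pi else \<phi> (j+1)))}"

definition hamiltonian :: "nat \<Rightarrow> nat \<Rightarrow> real \<Rightarrow> real \<Rightarrow> config \<Rightarrow> real" where
  "hamiltonian m n p q = (\<lambda>(\<phi>, \<psi>, \<theta>).
       p * (\<Sum>j=1..m. \<Sum>k=1..2*m*n. ln (cmod (cis (\<phi> j) - cis (\<theta> k))))
     + q * (\<Sum>j=1..m. \<Sum>k=1..2*m*n. ln (cmod (cis (\<psi> j) - cis (\<theta> k))))
     + (\<Sum>j=1..2*m*n. \<Sum>k=1..<j. ln (cmod (cis (\<theta> j) - cis (\<theta> k))))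
     + p\<^sup>2 * (\<Sum>j=1..m. \<Sum>k=1..<j. ln (cmod (cis (\<phi> j) - cis (\<phi> k))))
     + q\<^sup>2 * (\<Sum>j=1..m. \<Sum>k=1..<j. ln (cmod (cis (\<psi> j) - cis (\<psi> k))))
     + p * q * (\<Sum>j=1..m. \<Sum>k=1..m. ln (cmod (cis (\<phi> j) - cis (\<psi> k)))))"

definition jacobi_config :: "nat \<Rightarrow> nat \<Rightarrow> real \<Rightarrow> real \<Rightarrow> config \<Rightarrow> bool" where
  "jacobi_config m n p q = (\<lambda>(\<phi>, \<psi>, \<theta>).
     (\<phi>, \<psi>, \<theta>) \<in> config_space m n \<and>
     (\<lambda>j. cis (\<phi> j)) ` {1..m} = {z. z ^ m = 1} \<and>
     (\<lambda>j. cis (\<psi> j)) ` {1..m} = {z. z ^ m = -1} \<and>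
     (\<lambda>j. cis (\<theta> j)) ` {1..2*m*n} =
       {z. poly (circle_poly m n (jacobi_poly n (p - 1/2) (q - 1/2))) z = 0})"

end

theory Submission
  imports Defs
begin

text \<open>
  In increasing angular order all charged points \<open>x\<^sub>r\<close> satisfy \<open>0 < x\<^sub>s - x\<^sub>r < 2\<pi>\<close> for \<open>r < s\<close>, and
  the pair interaction \<open>ln (2 sin ((x\<^sub>s - x\<^sub>r) / 2))\<close> is strictly concave in the gap. Since \<open>\<phi>\<^sub>1 = 0\<close> removes
  the rotations, a configuration in which all forces
  \<open>\<Sum>\<^sub>s w\<^sub>s cot ((x\<^sub>r - x\<^sub>s) / 2)\<close> vanish is therefore the unique maximum, and it suffices to exhibit one.

  For the configuration built from \<open>\<tau>\<^sub>i = arccos x\<^sub>i\<close>, with \<open>x\<^sub>i\<close> the zeros of the Jacobi polynomial, the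
  identity \<open>\<Sum>\<^sub>j cot (y + \<pi>j/m) = m cot (my)\<close> reduces the force at \<open>x\<close> to an odd, \<open>2\<pi>\<close>-periodic function of
  \<open>mx\<close>. It vanishes at \<open>0\<close> and \<open>\<pi>\<close> by symmetry, and at \<open>\<tau>\<^sub>k\<close> by the relation of Stieltjes
  \<open>y''(x\<^sub>k) = 2 y'(x\<^sub>k) \<Sum>\<^sub>i 1 / (x\<^sub>k - x\<^sub>i)\<close> combined with the Jacobi differential equation.
\<close>

section \<open>Jacobi polynomials and their zeros\<close>

text \<open>The parameters \<open>p - 1/2\<close> and \<open>q - 1/2\<close> come from the mirror
  symmetry. On the scale \<open>m * x\<close> the free points sit at \<plusminus>\<tau>_i, so the
  one at \<tau>_k feels, besides the other mirror pairs, its own image at -\<tau>_k, with force cot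
  \<tau>_k. Times sin \<tau>_k this is x = (1 + x)/2 - (1 - x)/2 with x = cos \<tau>_k: the effect
  of an extra half charge on each of the two walls (the points \<phi> and \<psi>). The equilibrium
  of the zeros for parameters a, b asks for weights a + 1 and b + 1 in these places, so a + 1 = p +
  1/2 and b + 1 = q + 1/2. The Jacobi polynomial is given by a sum, so its differential equation has
  to be derived. Two ladder relations between the parameters (a, b) and (a + 1, b + 1) give it, and
  one of them also yields the zeros without orthogonality. Energy and forces are treated as sums
  over one merged sequence of charges. The values \<open>ln 0 = 0\<close> and
  \<open>cot 0 = 0\<close> make the diagonal terms vanish, so no index has to be excluded.\<close>

lemma gbinomial_absorb_next:
  fixes a :: "'a::field_char_0"
  shows "of_nat (Suc k) * (a gchoose Suc k) = (a - of_nat k) * (a gchoose k)"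
  using gbinomial_mult_1[of a k] by (simp add: algebra_simps)

lemma poly_jacobi_poly:
  "poly (jacobi_poly n a b) x =
     (\<Sum>s\<le>n. ((real n + a) gchoose (n - s)) * ((real n + b) gchoose s) *
        ((x - 1) / 2) ^ s * ((x + 1) / 2) ^ (n - s))"
proof -
  have "poly [:- 1 / 2, 1 / 2:] x = (x - 1) / 2" "poly [:1 / 2, 1 / 2:] x = (x + 1) / 2"
    by (simp_all add: field_simps)
  then show ?thesis
    by (simp only: jacobi_poly_def poly_sum poly_smult poly_mult poly_power mult.assoc)
qed

text \<open>The coefficients for degree \<open>Suc n\<close> with parameters \<open>a, b\<close> and
  for degree \<open>n\<close> with \<open>a + 1, b + 1\<close> have the same upper binomial
  arguments; only the lower indices move by one. Both ladder relations below rest on these two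
  identities.\<close>

lemma jacobi_coeff_step:
  fixes a b :: real
  assumes "s \<le> n"
  shows "real (Suc n - s) * ((real (Suc n) + a) gchoose (Suc n - s)) =
         (a + 1 + real s) * ((real n + (a + 1)) gchoose (n - s))"
    and "real (Suc s) * ((real (Suc n) + b) gchoose (Suc s)) =
         (real n + b + 1 - real s) * ((real n + (b + 1)) gchoose s)"
proof -
  have "Suc n - s = Suc (n - s)" "real (n - s) = real n - real s"
    using assms by auto
  then show "real (Suc n - s) * ((real (Suc n) + a) gchoose (Suc n - s)) =
         (a + 1 + real s) * ((real n + (a + 1)) gchoose (n - s))"
    using gbinomial_absorb_next[of "n - s" "real (Suc n) + a"]
    by (simp add: algebra_simps)
  show "real (Suc s) * ((real (Suc n) + b) gchoose (Suc s)) =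
         (real n + b + 1 - real s) * ((real n + (b + 1)) gchoose s)"
    using gbinomial_absorb_next[of s "real (Suc n) + b"]
    by (simp add: algebra_simps)
qed

text \<open>The truncated exponents \<open>s - 1\<close> at \<open>s = 0\<close> and
  \<open>n - s - 1\<close> at \<open>s = n\<close> do no harm: each stands next to a factor
  0.\<close>

lemma poly_pderiv_jacobi_poly:
  "poly (pderiv (jacobi_poly n a b)) x =
     (\<Sum>s\<le>n. ((real n + a) gchoose (n - s)) * ((real n + b) gchoose s) *
        (real s * ((x - 1) / 2) ^ (s - 1) * ((x + 1) / 2) ^ (n - s) +
         real (n - s) * ((x - 1) / 2) ^ s * ((x + 1) / 2) ^ (n - s - 1)) / 2)"
proof (rule DERIV_unique[OF poly_DERIV])
  have u: "((\<lambda>x. ((x - 1) / 2) ^ s) has_real_derivative real s * ((x - 1) / 2) ^ (s - 1) * (1 / 2)) (at x)"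
    and v: "((\<lambda>x. ((x + 1) / 2) ^ s) has_real_derivative real s * ((x + 1) / 2) ^ (s - 1) * (1 / 2)) (at x)" for s
    by (auto intro!: derivative_eq_intros)
  have *: "((\<lambda>x. c * ((x - 1) / 2) ^ s * ((x + 1) / 2) ^ k) has_real_derivative
       c * (real s * ((x - 1) / 2) ^ (s - 1) * ((x + 1) / 2) ^ k +
         real k * ((x - 1) / 2) ^ s * ((x + 1) / 2) ^ (k - 1)) / 2) (at x)" for c s k
    unfolding mult.assoc[of c]
    by (rule DERIV_cong[OF DERIV_cmult[OF DERIV_mult[OF u v]]]) (simp add: distrib_left mult_ac add_divide_distrib)
  show "(poly (jacobi_poly n a b) has_real_derivative
     (\<Sum>s\<le>n. ((real n + a) gchoose (n - s)) * ((real n + b) gchoose s) *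
        (real s * ((x - 1) / 2) ^ (s - 1) * ((x + 1) / 2) ^ (n - s) +
         real (n - s) * ((x - 1) / 2) ^ s * ((x + 1) / 2) ^ (n - s - 1)) / 2)) (at x)"
    unfolding poly_jacobi_poly[abs_def]
    by (rule DERIV_sum) (rule *)
qed

text \<open>Collecting the monomial \<open>u ^ s * v ^ (n - s)\<close> gives the weights
  \<open>n + b + 1 - s\<close> and \<open>a + 1 + s\<close>, whose sum no longer depends on
  \<open>s\<close>. This ladder step lowers the degree and raises both parameters.\<close>

lemma pderiv_jacobi_poly:
  "pderiv (jacobi_poly (Suc n) a b) = smult ((real n + a + b + 2) / 2) (jacobi_poly n (a + 1) (b + 1))"
proof (rule poly_ext)
  fix x :: real
  define u v where "u = (x - 1) / 2" and "v = (x + 1) / 2"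
  define A B where "A s = (real (Suc n) + a) gchoose (Suc n - s)"
    and "B s = (real (Suc n) + b) gchoose s" for s
  define A' B' where "A' s = (real n + (a + 1)) gchoose (n - s)"
    and "B' s = (real n + (b + 1)) gchoose s" for s
  have B': "B' s = B s" for s by (simp add: B_def B'_def algebra_simps)
  have A': "A' s = A (Suc s)" for s by (simp add: A_def A'_def algebra_simps)
  have "2 * poly (pderiv (jacobi_poly (Suc n) a b)) x =
     (\<Sum>s\<le>Suc n. A s * B s * (real s * u ^ (s - 1) * v ^ (Suc n - s) + real (Suc n - s) * u ^ s * v ^ (Suc n - s - 1)))"
    unfolding poly_pderiv_jacobi_poly sum_distrib_left A_def B_def u_def v_def by (rule sum.cong) simp_all
  also have "\<dots> = (\<Sum>s\<le>Suc n. A s * B s * real s * u ^ (s - 1) * v ^ (Suc n - s)) +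
      (\<Sum>s\<le>Suc n. A s * B s * real (Suc n - s) * u ^ s * v ^ (Suc n - s - 1))"
    by (simp only: distrib_left sum.distrib mult.assoc)
  also have "(\<Sum>s\<le>Suc n. A s * B s * real s * u ^ (s - 1) * v ^ (Suc n - s)) =
     (\<Sum>s\<le>n. A (Suc s) * B (Suc s) * real (Suc s) * u ^ s * v ^ (n - s))"
    by (subst sum.atMost_Suc_shift) simp
  also have "(\<Sum>s\<le>Suc n. A s * B s * real (Suc n - s) * u ^ s * v ^ (Suc n - s - 1)) =
     (\<Sum>s\<le>n. A s * B s * real (Suc n - s) * u ^ s * v ^ (n - s))"
    by simp
  also have "(\<Sum>s\<le>n. A (Suc s) * B (Suc s) * real (Suc s) * u ^ s * v ^ (n - s)) + \<dots> =
     (\<Sum>s\<le>n. (real n + a + b + 2) * (A' s * B' s * u ^ s * v ^ (n - s)))"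
    unfolding sum.distrib[symmetric]
  proof (rule sum.cong[OF refl])
    fix s assume "s \<in> {..n}"
    then have s: "s \<le> n" by simp
    have "real (Suc n - s) * A s = (a + 1 + real s) * A' s" 
         "real (Suc s) * B (Suc s) = (real n + b + 1 - real s) * B' s"
      using jacobi_coeff_step[OF s] unfolding A_def B_def A'_def B'_def by auto
    moreover have "A (Suc s) * B (Suc s) * real (Suc s) * u ^ s * v ^ (n - s) +
         A s * B s * real (Suc n - s) * u ^ s * v ^ (n - s) =
         (A' s * (real (Suc s) * B (Suc s)) + B' s * (real (Suc n - s) * A s)) * (u ^ s * v ^ (n - s))"
      by (simp add: A' B' algebra_simps)
    ultimately show "A (Suc s) * B (Suc s) * real (Suc s) * u ^ s * v ^ (n - s) +
         A s * B s * real (Suc n - s) * u ^ s * v ^ (n - s) =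
         (real n + a + b + 2) * (A' s * B' s * u ^ s * v ^ (n - s))"
      by (simp only:) (simp add: algebra_simps)
  qed
  also have "\<dots> = (real n + a + b + 2) * poly (jacobi_poly n (a + 1) (b + 1)) x"
    unfolding poly_jacobi_poly sum_distrib_left A'_def B'_def u_def v_def ..
  finally show "poly (pderiv (jacobi_poly (Suc n) a b)) x =
      poly (smult ((real n + a + b + 2) / 2) (jacobi_poly n (a + 1) (b + 1))) x"
    by simp
qed

text \<open>The opposite ladder step. With 1 - x^2 = -4uv, 1 - x = -2u and 1 + x = 2v the right-hand
  side is homogeneous of degree \<open>Suc n\<close> in \<open>u, v\<close>; the weights of a
  monomial become \<open>Suc n - s\<close> and \<open>s\<close>, which add up to
  \<open>Suc n\<close>.\<close>

lemma jacobi_poly_raising: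
  "- 2 * real (Suc n) * poly (jacobi_poly (Suc n) a b) x =
     (1 - x\<^sup>2) * poly (pderiv (jacobi_poly n (a + 1) (b + 1))) x +
     ((b + 1) * (1 - x) - (a + 1) * (1 + x)) * poly (jacobi_poly n (a + 1) (b + 1)) x"
proof -
  define u v where "u = (x - 1) / 2" and "v = (x + 1) / 2"
  define A B where "A s = (real (Suc n) + a) gchoose (Suc n - s)"
    and "B s = (real (Suc n) + b) gchoose s" for s
  define A' B' where "A' s = (real n + (a + 1)) gchoose (n - s)"
    and "B' s = (real n + (b + 1)) gchoose s" for s
  have B': "B' s = B s" for s by (simp add: B_def B'_def algebra_simps)
  have A': "A' s = A (Suc s)" for s by (simp add: A_def A'_def algebra_simps)
  have x: "1 - x\<^sup>2 = - 4 * u * v" "1 - x = - 2 * u" "1 + x = 2 * v"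
    by (auto simp: u_def v_def field_simps power2_eq_square)
  have P: "poly (jacobi_poly (Suc n) a b) x = (\<Sum>s\<le>Suc n. A s * B s * u ^ s * v ^ (Suc n - s))"
    unfolding poly_jacobi_poly A_def B_def u_def v_def ..
  have Q: "poly (jacobi_poly n (a + 1) (b + 1)) x = (\<Sum>s\<le>n. A' s * B' s * u ^ s * v ^ (n - s))"
    unfolding poly_jacobi_poly A'_def B'_def u_def v_def ..
  have Q': "poly (pderiv (jacobi_poly n (a + 1) (b + 1))) x = (\<Sum>s\<le>n. A' s * B' s *
      (real s * u ^ (s - 1) * v ^ (n - s) + real (n - s) * u ^ s * v ^ (n - s - 1)) / 2)"
    unfolding poly_pderiv_jacobi_poly A'_def B'_def u_def v_def ..
  have "(1 - x\<^sup>2) * poly (pderiv (jacobi_poly n (a + 1) (b + 1))) x +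
     ((b + 1) * (1 - x) - (a + 1) * (1 + x)) * poly (jacobi_poly n (a + 1) (b + 1)) x =
     - 2 * (\<Sum>s\<le>n. A' s * B' s * (a + 1 + real s) * u ^ s * v ^ (Suc n - s) +
         A' s * B' s * (real n + b + 1 - real s) * u ^ Suc s * v ^ (n - s))"
    unfolding x Q Q' sum_distrib_left sum.distrib[symmetric]
  proof (rule sum.cong[OF refl])
    fix s assume "s \<in> {..n}"
    then have s: "s \<le> n" by simp
    have 1: "real s * u ^ (s - 1) * u = real s * u ^ s" by (cases s) auto
    have 2: "real (n - s) * v ^ (n - s - 1) * v = real (n - s) * v ^ (n - s)" by (cases "n - s") auto
    have 3: "v ^ (Suc n - s) = v * v ^ (n - s)" using s by (simp add: Suc_diff_le)
    have 4: "real (n - s) = real n - real s" using s by simp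
    have gen: "- 4 * u * v * (c * (X + Y) / 2) = - 2 * c * (u * v * X + u * v * Y)" for c X Y :: real
      by (simp add: field_simps)
    have "u * v * (real s * u ^ (s - 1) * v ^ (n - s)) = (real s * u ^ (s - 1) * u) * v ^ (n - s) * v"
      "u * v * (real (n - s) * u ^ s * v ^ (n - s - 1)) = (real (n - s) * v ^ (n - s - 1) * v) * u ^ s * u"
      by (simp_all only: mult_ac)
    then have "- 4 * u * v * (A' s * B' s *
      (real s * u ^ (s - 1) * v ^ (n - s) + real (n - s) * u ^ s * v ^ (n - s - 1)) / 2) =
      - 2 * (A' s * B' s) * ((real s * u ^ (s - 1) * u) * v ^ (n - s) * v + (real (n - s) * v ^ (n - s - 1) * v) * u ^ s * u)"
      unfolding gen by simp
    also have "\<dots> = - 2 * (A' s * B' s) * (real s * u ^ s * v ^ (n - s) * v + (real n - real s) * v ^ (n - s) * u ^ s * u)"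
      by (simp only: 1 2) (simp only: 4)
    finally show "- 4 * u * v * (A' s * B' s *
      (real s * u ^ (s - 1) * v ^ (n - s) + real (n - s) * u ^ s * v ^ (n - s - 1)) / 2) +
      ((b + 1) * (- 2 * u) - (a + 1) * (2 * v)) * (A' s * B' s * u ^ s * v ^ (n - s)) =
      - 2 * (A' s * B' s * (a + 1 + real s) * u ^ s * v ^ (Suc n - s) +
         A' s * B' s * (real n + b + 1 - real s) * u ^ Suc s * v ^ (n - s))"
      unfolding 3 by (simp add: algebra_simps)
  qed
  also have "(\<Sum>s\<le>n. A' s * B' s * (a + 1 + real s) * u ^ s * v ^ (Suc n - s) +
         A' s * B' s * (real n + b + 1 - real s) * u ^ Suc s * v ^ (n - s)) =
     (\<Sum>s\<le>n. real (Suc n - s) * A s * B s * u ^ s * v ^ (Suc n - s) +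
         A (Suc s) * (real (Suc s) * B (Suc s)) * u ^ Suc s * v ^ (Suc n - Suc s))"
  proof (rule sum.cong[OF refl])
    fix s assume "s \<in> {..n}"
    then have s: "s \<le> n" by simp
    have "real (Suc n - s) * A s = (a + 1 + real s) * A' s" 
         "real (Suc s) * B (Suc s) = (real n + b + 1 - real s) * B' s"
      using jacobi_coeff_step[OF s] unfolding A_def B_def A'_def B'_def by auto
    then show "A' s * B' s * (a + 1 + real s) * u ^ s * v ^ (Suc n - s) +
         A' s * B' s * (real n + b + 1 - real s) * u ^ Suc s * v ^ (n - s) =
         real (Suc n - s) * A s * B s * u ^ s * v ^ (Suc n - s) +
         A (Suc s) * (real (Suc s) * B (Suc s)) * u ^ Suc s * v ^ (Suc n - Suc s)"
      by (simp only: A' B') (simp add: algebra_simps)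
  qed
  \<comment> \<open>Both sums extend to \<open>s \<le> Suc n\<close> at no cost: the first weight
    vanishes at \<open>s = Suc n\<close>, and the second, after the shift, at
    \<open>s = 0\<close>.\<close>
  also have "\<dots> = (\<Sum>s\<le>Suc n. real (Suc n - s) * A s * B s * u ^ s * v ^ (Suc n - s)) +
      (\<Sum>s\<le>Suc n. A s * (real s * B s) * u ^ s * v ^ (Suc n - s))"
  proof -
    have "(\<Sum>s\<le>Suc n. A s * (real s * B s) * u ^ s * v ^ (Suc n - s)) =
        (\<Sum>s\<le>n. A (Suc s) * (real (Suc s) * B (Suc s)) * u ^ Suc s * v ^ (Suc n - Suc s))"
      by (subst sum.atMost_Suc_shift) (simp only: of_nat_0 mult_zero_left mult_zero_right add_0_left)
    moreover have "(\<Sum>s\<le>Suc n. real (Suc n - s) * A s * B s * u ^ s * v ^ (Suc n - s)) =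
        (\<Sum>s\<le>n. real (Suc n - s) * A s * B s * u ^ s * v ^ (Suc n - s))"
      by (subst sum.atMost_Suc) (simp only: diff_self_eq_0 of_nat_0 mult_zero_left add_0_right)
    ultimately show ?thesis unfolding sum.distrib by (simp only:)
  qed
  also have "\<dots> = (\<Sum>s\<le>Suc n. real (Suc n) * (A s * B s * u ^ s * v ^ (Suc n - s)))"
    unfolding sum.distrib[symmetric]
    by (rule sum.cong) (auto simp: of_nat_diff algebra_simps)
  also have "\<dots> = real (Suc n) * poly (jacobi_poly (Suc n) a b) x"
    unfolding P sum_distrib_left ..
  finally show ?thesis by (simp only: mult.assoc mult_minus_left)
qed

text \<open>Going down by \<open>pderiv_jacobi_poly\<close> and up again by
  \<open>jacobi_poly_raising\<close> returns to the same polynomial, multiplied by (n + a + b + 1)/2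
  and by -2n. Degree 0 has nothing below it and is checked directly.\<close>

lemma jacobi_poly_ode:
  "(1 - x\<^sup>2) * poly (pderiv (pderiv (jacobi_poly n a b))) x +
   (b - a - (a + b + 2) * x) * poly (pderiv (jacobi_poly n a b)) x +
   real n * (real n + a + b + 1) * poly (jacobi_poly n a b) x = 0"
proof (cases n)
  case 0
  then show ?thesis by (simp add: jacobi_poly_def pderiv_smult)
next
  case (Suc k)
  have k: "b - a - (a + b + 2) * x = (b + 1) * (1 - x) - (a + 1) * (1 + x)"
    by (simp add: algebra_simps)
  have "(1 - x\<^sup>2) * poly (pderiv (pderiv (jacobi_poly n a b))) x +
     (b - a - (a + b + 2) * x) * poly (pderiv (jacobi_poly n a b)) x =
     (real k + a + b + 2) / 2 * ((1 - x\<^sup>2) * poly (pderiv (jacobi_poly k (a + 1) (b + 1))) x +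
     ((b + 1) * (1 - x) - (a + 1) * (1 + x)) * poly (jacobi_poly k (a + 1) (b + 1)) x)"
    unfolding k Suc pderiv_jacobi_poly pderiv_smult poly_smult
    by (simp only: distrib_left mult.left_commute[of "(real k + a + b + 2) / 2"])
  also have "\<dots> = - (real n * (real n + a + b + 1) * poly (jacobi_poly n a b) x)"
  proof -
    have "real n + a + b + 1 = real k + a + b + 2" by (simp add: Suc)
    then show ?thesis unfolding jacobi_poly_raising[symmetric] Suc by (simp add: field_simps)
  qed
  finally show ?thesis by simp
qed

section \<open>Zeros in the open interval (-1, 1)\<close>

lemma poly_jacobi_poly_1_pos:
  assumes "a > -1"
  shows "poly (jacobi_poly n a b) 1 > 0"
proof -
  have "poly (jacobi_poly n a b) 1 = (\<Sum>s\<le>n. if s = 0 then (real n + a) gchoose n else 0)"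
    unfolding poly_jacobi_poly by (rule sum.cong) auto
  also have "\<dots> = (real n + a) gchoose n" by simp
  also have "\<dots> > 0"
    unfolding gbinomial_prod_rev using assms by (intro divide_pos_pos prod_pos) auto
  finally show ?thesis .
qed

text \<open>Rolle's theorem between neighbouring zeros, organised by removing the largest one: the
  induction supplies zeros of the derivative below \<open>Max A'\<close>, and one more lies beyond
  it. Derivatives are asked for only in the open interval, since the weighted function this is meant
  for need not be differentiable at the ends.\<close>

lemma Rolle_zeros:
  fixes f f' :: "real \<Rightarrow> real"
  assumes cont: "continuous_on {l..u} f"
    and deriv: "\<And>x. l < x \<Longrightarrow> x < u \<Longrightarrow> (f has_real_derivative f' x) (at x)"
    and "finite A" "card A = Suc k" "A \<subseteq> {l..u}" "\<And>x. x \<in> A \<Longrightarrow> f x = 0"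
  shows "\<exists>B. finite B \<and> card B = k \<and> B \<subseteq> {Min A<..<Max A} \<and> (\<forall>x\<in>B. f' x = 0)"
  using assms(3-6)
proof (induction k arbitrary: A)
  case 0
  then show ?case by (intro exI[of _ "{}"]) auto
next
  case (Suc k)
  define M A' where "M = Max A" and "A' = A - {M}"
  have "A \<noteq> {}" using Suc.prems by auto
  then have M: "M \<in> A" using Suc.prems(1) by (simp add: M_def)
  have A': "finite A'" "card A' = Suc k" "A' \<subseteq> {l..u}" "\<And>x. x \<in> A' \<Longrightarrow> f x = 0"
    using Suc.prems M by (auto simp: A'_def)
  obtain B where B: "finite B" "card B = k" "B \<subseteq> {Min A'<..<Max A'}" "\<forall>x\<in>B. f' x = 0"
    using Suc.IH[OF A'] by auto
  have ne: "A' \<noteq> {}" using A' by auto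
  define K where "K = Max A'"
  have K: "K \<in> A'" "K \<in> A" using A' ne Max_in[of A'] by (auto simp: K_def A'_def)
  have KM: "K < M"
    using K Suc.prems(1) by (auto simp: A'_def M_def less_le)
  have bd: "l \<le> K" "M \<le> u" using K M Suc.prems by auto
  have "\<exists>z>K. z < M \<and> (f has_real_derivative 0) (at z)"
  proof (rule Rolle[OF KM])
    show "f K = f M" using K M Suc.prems by auto
    show "continuous_on {K..M} f" by (rule continuous_on_subset[OF cont]) (use bd in auto)
    show "f differentiable (at x)" if "K < x" "x < M" for x
      using deriv[of x] that bd by (auto simp: real_differentiable_def)
  qed
  then obtain z where z: "K < z" "z < M" "(f has_real_derivative 0) (at z)" by auto
  have fz: "f' z = 0" using DERIV_unique[OF z(3) deriv[of z]] z bd by auto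
  have "Min A \<le> Min A'" using ne Suc.prems by (intro Min_antimono) (auto simp: A'_def)
  moreover have "Min A' \<le> K" using K A' by auto
  ultimately have "insert z B \<subseteq> {Min A<..<Max A}"
    using B z KM by (force simp: K_def[symmetric] M_def[symmetric])
  moreover have "z \<notin> B" using B z by (auto simp: K_def)
  ultimately show ?case using B fz by (intro exI[of _ "insert z B"]) auto
qed

text \<open>By the raising formula, \<open>(1 - x)\<^sup>a (1 + x)\<^sup>b P\<^sub>n\<^sub>+\<^sub>1\<close> with parameters \<open>a, b\<close> is a multiple of the
  derivative of \<open>(1 - x)\<^sup>a\<^sup>+\<^sup>1 (1 + x)\<^sup>b\<^sup>+\<^sup>1 P\<^sub>n\<close> with parameters \<open>a + 1, b + 1\<close>, which also vanishes at
  both ends of the interval; Rolle's theorem gains one zero.\<close>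

lemma jacobi_poly_zeros:
  assumes "a > -1" "b > -1"
  shows "\<exists>S. finite S \<and> card S = n \<and> S \<subseteq> {-1<..<1} \<and> (\<forall>x\<in>S. poly (jacobi_poly n a b) x = 0)"
  using assms
proof (induction n arbitrary: a b)
  case 0
  then show ?case by (intro exI[of _ "{}"]) auto
next
  case (Suc n)
  obtain S where S: "finite S" "card S = n" "S \<subseteq> {-1<..<1}" 
      "\<forall>x\<in>S. poly (jacobi_poly n (a + 1) (b + 1)) x = 0"
    using Suc.IH[of "a + 1" "b + 1"] Suc.prems by auto
  define Q where "Q = jacobi_poly n (a + 1) (b + 1)"
  define f where "f x = (1 - x) powr (a + 1) * (1 + x) powr (b + 1) * poly Q x" for x
  define f' where "f' x = (1 - x) powr a * (1 + x) powr b *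
     (- 2 * real (Suc n) * poly (jacobi_poly (Suc n) a b) x)" for x
  have cont: "continuous_on {-1..1} f"
    unfolding f_def using Suc.prems
    by (intro continuous_intros continuous_on_powr') auto
  have deriv: "(f has_real_derivative f' x) (at x)" if "- 1 < x" "x < 1" for x
  proof -
    have "(f has_real_derivative
        (1 - x) powr (a + 1) * (1 + x) powr (b + 1) * poly (pderiv Q) x +
        ((1 - x) powr (a + 1) * ((b + 1) * (1 + x) powr b) +
         - ((a + 1) * (1 - x) powr a) * (1 + x) powr (b + 1)) * poly Q x) (at x)"
      unfolding f_def using that
      by (auto intro!: derivative_eq_intros)
    also have "(1 - x) powr (a + 1) = (1 - x) * (1 - x) powr a"
      using that by (simp add: powr_add)
    also have "(1 + x) powr (b + 1) = (1 + x) * (1 + x) powr b"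
      using that by (simp add: powr_add)
    also have "(1 - x) * (1 - x) powr a * ((1 + x) * (1 + x) powr b) * poly (pderiv Q) x +
        ((1 - x) * (1 - x) powr a * ((b + 1) * (1 + x) powr b) +
         - ((a + 1) * (1 - x) powr a) * ((1 + x) * (1 + x) powr b)) * poly Q x = f' x"
      unfolding f'_def jacobi_poly_raising Q_def[symmetric]
      by (simp add: algebra_simps power2_eq_square)
    finally show ?thesis .
  qed
  have ends: "f (-1) = 0" "f 1 = 0" using Suc.prems by (auto simp: f_def)
  \<comment> \<open>The weight tends to 0 at both ends because its exponents \<open>a + 1\<close>
    and \<open>b + 1\<close> are positive. Together with the zeros of \<open>Q\<close> this makes
    \<open>n + 2\<close> zeros of \<open>f\<close>, hence \<open>n + 1\<close> of
    \<open>f'\<close>.\<close>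
  define T where "T = insert (-1) (insert 1 S)"
  have "-1 \<notin> S" "1 \<notin> S" using S by auto
  then have T: "finite T" "card T = Suc (Suc n)" "T \<subseteq> {-1..1}" "\<And>x. x \<in> T \<Longrightarrow> f x = 0"
    using S ends by (auto simp: T_def f_def Q_def)
  obtain B where B: "finite B" "card B = Suc n" "B \<subseteq> {Min T<..<Max T}" "\<forall>x\<in>B. f' x = 0"
    using Rolle_zeros[OF cont deriv T] by auto
  have "-1 \<le> Min T" "Max T \<le> 1" using T by (auto simp: T_def)
  then have B': "B \<subseteq> {-1<..<1}" using B by force
  have "\<forall>x\<in>B. poly (jacobi_poly (Suc n) a b) x = 0"
  proof
    fix x assume "x \<in> B"
    then have "-1 < x" "x < 1" "f' x = 0" using B B' by auto
    then show "poly (jacobi_poly (Suc n) a b) x = 0" by (auto simp: f'_def)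
  qed
  then show ?case using B B' by (intro exI[of _ B]) auto
qed

section \<open>Factorisation over the zeros and the Stieltjes relation\<close>

lemma poly_eq_smult_prod_roots:
  fixes P :: "'a::field poly"
  assumes "finite S" "\<forall>x\<in>S. poly P x = 0" "degree P \<le> card S"
  shows "\<exists>c. P = smult c (\<Prod>x\<in>S. [:-x, 1:])"
proof -
  have "\<exists>Q. P = Q * (\<Prod>x\<in>S. [:-x, 1:])"
    using assms(1,2)
  proof (induction S)
    case (insert y S)
    then obtain Q where Q: "P = Q * (\<Prod>x\<in>S. [:-x, 1:])" by auto
    have "poly (\<Prod>x\<in>S. [:-x, 1:]) y \<noteq> 0"
      using insert by (auto simp: poly_prod)
    then have "poly Q y = 0" using insert.prems Q by auto
    then obtain R where "Q = [:-y, 1:] * R" by (auto simp: poly_eq_0_iff_dvd elim: dvdE)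
    then have "P = R * (\<Prod>x\<in>insert y S. [:-x, 1:])"
      by (simp only: Q prod.insert[OF insert.hyps] mult_ac)
    then show ?case by blast
  qed auto
  then obtain Q where Q: "P = Q * (\<Prod>x\<in>S. [:-x, 1:])" by auto
  have d: "degree (\<Prod>x\<in>S. [:-x, 1:]) = card S"
    by (subst degree_prod_eq_sum_degree) auto
  have nz: "(\<Prod>x\<in>S. [:-x, 1:]) \<noteq> (0 :: 'a poly)" using assms(1) by auto
  have "degree Q = 0"
  proof (cases "Q = 0")
    case False
    then have "degree P = degree Q + card S" using nz d by (simp add: Q degree_mult_eq)
    then show ?thesis using assms(3) by simp
  qed auto
  then obtain c where "Q = [:c:]" by (elim degree_eq_zeroE)
  then show ?thesis using Q by (intro exI[of _ c]) auto
qed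

lemma pderiv_prod_linear_ratio:
  fixes a :: "'a::field"
  assumes "finite S" "a \<notin> S"
  shows "poly (pderiv (\<Prod>x\<in>S. [:-x, 1:])) a =
     poly (\<Prod>x\<in>S. [:-x, 1:]) a * (\<Sum>x\<in>S. 1 / (a - x))"
  using assms
proof (induction S)
  case (insert y S)
  then have "a - y \<noteq> 0" by auto
  have "poly (pderiv ([:-y, 1:] * (\<Prod>x\<in>S. [:-x, 1:]))) a =
      poly (\<Prod>x\<in>S. [:-x, 1:]) a + (a - y) * poly (pderiv (\<Prod>x\<in>S. [:-x, 1:])) a"
    by (simp only: pderiv_mult) (simp add: pderiv_pCons algebra_simps)
  also have "poly (pderiv (\<Prod>x\<in>S. [:-x, 1:])) a = poly (\<Prod>x\<in>S. [:-x, 1:]) a * (\<Sum>x\<in>S. 1 / (a - x))"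
    using insert by auto
  also have "poly (\<Prod>x\<in>S. [:-x, 1:]) a + (a - y) * \<dots> =
      (a - y) * poly (\<Prod>x\<in>S. [:-x, 1:]) a * (1 / (a - y) + (\<Sum>x\<in>S. 1 / (a - x)))"
    using \<open>a - y \<noteq> 0\<close> by (simp add: distrib_left)
  also have "(a - y) * poly (\<Prod>x\<in>S. [:-x, 1:]) a = poly ([:-y, 1:] * (\<Prod>x\<in>S. [:-x, 1:])) a"
    by (simp only: poly_mult) simp
  finally show ?case
    by (simp only: prod.insert[OF insert.hyps] sum.insert[OF insert.hyps])
qed auto

text \<open>Write \<open>P = [:-a, 1:] * g\<close>. Then P'(a) = g(a) and P''(a) = 2 g'(a), and g'/g
  at \<open>a\<close> is the logarithmic derivative over the other roots. Since \<open>S\<close> is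
  a set, every root is simple, which gives the second claim.\<close>

lemma stieltjes_relation:
  fixes S :: "'a::field set"
  assumes "finite S" "a \<in> S" "P = smult c (\<Prod>x\<in>S. [:-x, 1:])"
  shows "poly (pderiv (pderiv P)) a = 2 * (\<Sum>x\<in>S - {a}. 1 / (a - x)) * poly (pderiv P) a"
    and "c \<noteq> 0 \<Longrightarrow> poly (pderiv P) a \<noteq> 0"
proof -
  define g where "g = smult c (\<Prod>x\<in>S - {a}. [:-x, 1:])"
  have P: "P = [:-a, 1:] * g"
    unfolding assms(3) g_def using assms(1,2) by (subst prod.remove[of S a]) auto
  have 1: "poly (pderiv P) a = poly g a" "poly (pderiv (pderiv P)) a = 2 * poly (pderiv g) a"
    unfolding P by (simp_all only: pderiv_mult pderiv_add) (simp_all add: pderiv_pCons)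
  show "poly (pderiv (pderiv P)) a = 2 * (\<Sum>x\<in>S - {a}. 1 / (a - x)) * poly (pderiv P) a"
    unfolding 1 g_def pderiv_smult poly_smult
    using assms(1) by (subst pderiv_prod_linear_ratio) auto
  show "poly (pderiv P) a \<noteq> 0" if "c \<noteq> 0"
    unfolding 1 g_def using that assms(1) by (auto simp: poly_prod)
qed

text \<open>The exact degree is never computed: the bound \<open>n\<close> on it, together with
  \<open>n\<close> distinct zeros, fixes the polynomial up to a constant, and the positive value at
  1 excludes the constant 0.\<close>

lemma jacobi_poly_factorisation:
  fixes a b :: real
  assumes ab: "a > -1" "b > -1" and S: "finite S" "card S = n" "\<forall>x\<in>S. poly (jacobi_poly n a b) x = 0"
  shows "\<exists>c. c \<noteq> 0 \<and> jacobi_poly n a b = smult c (\<Prod>x\<in>S. [:-x, 1:])"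
proof -
  have nz: "jacobi_poly n a b \<noteq> 0" using poly_jacobi_poly_1_pos[OF ab(1), of n b] by auto
  obtain c where c: "jacobi_poly n a b = smult c (\<Prod>x\<in>S. [:-x, 1:])"
    using poly_eq_smult_prod_roots[OF S(1,3)] S(2) degree_jacobi_poly_le by auto
  then show ?thesis using nz by auto
qed

text \<open>At a zero the undifferentiated term of the differential equation drops out, and
  simplicity of the zero allows division by P'. In electrostatic terms, unit charges at the zeros
  balance charges (a + 1)/2 at 1 and (b + 1)/2 at -1.\<close>

lemma jacobi_zeros_equilibrium:
  fixes a b :: real
  assumes ab: "a > -1" "b > -1" and S: "finite S" "card S = n" "\<forall>x\<in>S. poly (jacobi_poly n a b) x = 0"
    and x: "x \<in> S"
  shows "2 * (1 - x\<^sup>2) * (\<Sum>y\<in>S - {x}. 1 / (x - y)) + (b - a - (a + b + 2) * x) = 0"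
proof -
  obtain c where "c \<noteq> 0" and c: "jacobi_poly n a b = smult c (\<Prod>x\<in>S. [:-x, 1:])"
    using jacobi_poly_factorisation[OF ab S] by blast
  note st = stieltjes_relation[OF S(1) x c]
  have "((2 * (1 - x\<^sup>2) * (\<Sum>y\<in>S - {x}. 1 / (x - y)) + (b - a - (a + b + 2) * x))) *
     poly (pderiv (jacobi_poly n a b)) x = 0"
    using jacobi_poly_ode[of x n a b] S(3) x unfolding st(1) by (auto simp: algebra_simps)
  then show ?thesis using st(2)[OF \<open>c \<noteq> 0\<close>] by simp
qed

section \<open>Logarithmic interaction and cotangent sums\<close>

text \<open>The derivative of ln sin is cot, which decreases strictly on (0, pi); the mean value
  theorem turns this into strict concavity in tangent form, where the slopes are the forces.\<close>

lemma ln_sin_tangent: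
  fixes s t :: real
  assumes "0 < s" "s < pi" "0 < t" "t < pi"
  shows "ln (sin s) \<le> ln (sin t) + cot t * (s - t)"
    and "s \<noteq> t \<Longrightarrow> ln (sin s) < ln (sin t) + cot t * (s - t)"
proof -
  define f where "f x = ln (sin x) - cot t * x" for x
  have d: "(f has_real_derivative cot x - cot t) (at x)" if "0 < x" "x < pi" for x
  proof -
    have "((\<lambda>x. ln (sin x) - cot t * x) has_real_derivative 1 / sin x * cos x - cot t) (at x)"
      using sin_gt_zero[OF that] by (auto intro!: derivative_eq_intros DERIV_cmult_Id)
    then show ?thesis by (simp add: f_def[abs_def] cot_def)
  qed
  have cot_anti: "cot y < cot x" if "0 < x" "x < y" "y < pi" for x y :: real
  proof -
    have "cot x - cot y = sin (y - x) / (sin x * sin y)"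
      using sin_gt_zero[of x] sin_gt_zero[of y] that
      by (simp add: cot_def sin_diff field_simps)
    also have "\<dots> > 0"
      using sin_gt_zero[of x] sin_gt_zero[of y] sin_gt_zero[of "y - x"] that by simp
    finally show ?thesis by simp
  qed
  show lt: "ln (sin s) < ln (sin t) + cot t * (s - t)" if "s \<noteq> t"
  proof (cases "s < t")
    case True
    obtain z where z: "s < z" "z < t" "f t - f s = (t - s) * (cot z - cot t)"
      using MVT2[of s t f "\<lambda>x. cot x - cot t"] d assms True by force
    have "(t - s) * (cot z - cot t) > 0"
      using z True cot_anti[of z t] assms by (intro mult_pos_pos) auto
    then show ?thesis using z(3) by (simp add: f_def algebra_simps)
  next
    case False
    with that have st: "t < s" by simp
    obtain z where z: "t < z" "z < s" "f s - f t = (s - t) * (cot z - cot t)"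
      using MVT2[of t s f "\<lambda>x. cot x - cot t"] d assms st by force
    have "(s - t) * (cot z - cot t) < 0"
      using z st cot_anti[of t z] assms by (intro mult_pos_neg) auto
    then show ?thesis using z(3) by (simp add: f_def algebra_simps)
  qed
  then show "ln (sin s) \<le> ln (sin t) + cot t * (s - t)" by (cases "s = t") auto
qed

lemma cmod_cis_diff: "cmod (cis x - cis y) = 2 * \<bar>sin ((x - y) / 2)\<bar>"
proof -
  have "(cmod (cis x - cis y))\<^sup>2 = (2 * \<bar>sin ((x - y) / 2)\<bar>)\<^sup>2"
  proof -
    have "(cmod (cis x - cis y))\<^sup>2 = (cos x - cos y)\<^sup>2 + (sin x - sin y)\<^sup>2"
      by (simp add: cmod_power2)
    also have "\<dots> = ((sin x)\<^sup>2 + (cos x)\<^sup>2) + ((sin y)\<^sup>2 + (cos y)\<^sup>2) - 2 * (cos x * cos y + sin x * sin y)"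
      by (simp add: power2_eq_square algebra_simps)
    also have "\<dots> = 2 - 2 * cos (x - y)"
      by (simp add: cos_diff)
    also have "\<dots> = 2 - 2 * cos (2 * ((x - y) / 2))"
      by (simp only: times_divide_eq_right nonzero_mult_div_cancel_left zero_neq_numeral[symmetric] not_False_eq_True)
    also have "\<dots> = (2 * \<bar>sin ((x - y) / 2)\<bar>)\<^sup>2"
      unfolding cos_double_sin by (simp add: power_mult_distrib)
    finally show ?thesis .
  qed
  then show ?thesis by (rule power2_eq_imp_eq) auto
qed

text \<open>Half of each gap lies in (0, pi), the domain of concavity of ln sin, and the constant ln
  2 from the chord length cancels. The condition on both gaps expresses that the two points are in
  the same order in both configurations.\<close>

lemma ln_cmod_cis_diff_tangent:
  assumes "0 < x - y" "x - y < 2 * pi" "0 < x' - y'" "x' - y' < 2 * pi"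
  shows "ln (cmod (cis x' - cis y')) \<le>
       ln (cmod (cis x - cis y)) + cot ((x - y) / 2) * ((x' - y') - (x - y)) / 2"
    and "x' - y' \<noteq> x - y \<Longrightarrow> ln (cmod (cis x' - cis y')) <
       ln (cmod (cis x - cis y)) + cot ((x - y) / 2) * ((x' - y') - (x - y)) / 2"
proof -
  define s t where "s = (x' - y') / 2" and "t = (x - y) / 2"
  have st: "0 < s" "s < pi" "0 < t" "t < pi" using assms by (auto simp: s_def t_def)
  have pos: "sin s > 0" "sin t > 0" using st sin_gt_zero by auto
  have 1: "ln (cmod (cis x' - cis y')) = ln 2 + ln (sin s)" "ln (cmod (cis x - cis y)) = ln 2 + ln (sin t)"
    using pos unfolding cmod_cis_diff s_def t_def by (auto simp: ln_mult)
  have 2: "cot t * ((x' - y') - (x - y)) / 2 = cot t * (s - t)"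
    by (simp add: s_def t_def diff_divide_distrib)
  show "ln (cmod (cis x' - cis y')) \<le>
       ln (cmod (cis x - cis y)) + cot ((x - y) / 2) * ((x' - y') - (x - y)) / 2"
    unfolding 1 t_def[symmetric] 2 using ln_sin_tangent(1)[OF st] by simp
  show "ln (cmod (cis x' - cis y')) <
       ln (cmod (cis x - cis y)) + cot ((x - y) / 2) * ((x' - y') - (x - y)) / 2" if "x' - y' \<noteq> x - y"
  proof -
    have "s \<noteq> t" using that by (auto simp: s_def t_def)
    then show ?thesis unfolding 1 t_def[symmetric] 2 using ln_sin_tangent(2)[OF st] by simp
  qed
qed

section \<open>Cotangent sums over equally spaced angles\<close>

lemma cot_plus_pi: "cot (x + pi) = cot (x :: real)"
  by (simp add: cot_def)

lemma cot_plus_nat_pi: "cot (x + real k * pi) = cot (x :: real)"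
proof (induction k)
  case (Suc k)
  have "x + real (Suc k) * pi = (x + real k * pi) + pi" by (simp add: algebra_simps)
  then show ?case using Suc by (simp only: cot_plus_pi)
qed simp

text \<open>Through this Moebius transformation of \<open>cis (2 * t)\<close>, a sum of cotangents
  over equally spaced angles becomes a sum over roots of unity.\<close>

lemma cot_cis:
  fixes t :: real
  assumes "sin t \<noteq> 0"
  shows "complex_of_real (cot t) = \<i> * (1 + 2 / (cis (2 * t) - 1))"
proof -
  have e: "cis (2 * t) - 1 = 2 * \<i> * sin t * cis t"
    by (simp add: complex_eq_iff cos_double_sin sin_double power2_eq_square)
  have nz: "cis t \<noteq> 0" "complex_of_real (sin t) \<noteq> 0" using assms by auto
  have "\<i> * (1 + 2 / (cis (2 * t) - 1)) = \<i> + inverse (cis t) / sin t"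
    unfolding e using nz by (simp add: field_simps)
  also have "\<dots> = cot t"
    unfolding cis_inverse using assms by (simp add: complex_eq_iff cot_def field_simps)
  finally show ?thesis ..
qed

text \<open>Multiplied by \<open>w ^ m - 1\<close>, each term is a finite geometric sum. Summing
  over \<open>j\<close> first, orthogonality of the powers of the primitive root
  \<open>\<zeta>\<close> leaves only \<open>k = 0\<close>.\<close>

lemma sum_inverse_rotated_minus_1:
  fixes w \<zeta> :: complex
  assumes m: "m > 0" and \<zeta>: "\<And>k. 0 < k \<Longrightarrow> k < m \<Longrightarrow> \<zeta> ^ k \<noteq> 1" "\<zeta> ^ m = 1" and w: "w ^ m \<noteq> 1"
  shows "(\<Sum>j<m. 1 / (w * \<zeta> ^ j - 1)) = of_nat m / (w ^ m - 1)"
proof -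
  have *: "1 / (w * \<zeta> ^ j - 1) * (w ^ m - 1) = (\<Sum>k<m. w ^ k * (\<zeta> ^ k) ^ j)" for j
  proof -
    have "(w * \<zeta> ^ j) ^ m = w ^ m * (\<zeta> ^ m) ^ j"
      by (simp add: power_mult_distrib power_mult[symmetric] mult.commute)
    then have p: "(w * \<zeta> ^ j) ^ m = w ^ m" using \<zeta> by simp
    then have "w * \<zeta> ^ j \<noteq> 1" using w by auto
    then have "(w ^ m - 1) / (w * \<zeta> ^ j - 1) = (\<Sum>k<m. (w * \<zeta> ^ j) ^ k)"
      unfolding p[symmetric] by (subst geometric_sum) auto
    also have "\<dots> = (\<Sum>k<m. w ^ k * (\<zeta> ^ k) ^ j)"
      by (simp add: power_mult_distrib power_mult[symmetric] mult.commute)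
    finally show ?thesis by simp
  qed
  have "(\<Sum>j<m. 1 / (w * \<zeta> ^ j - 1)) * (w ^ m - 1) = (\<Sum>j<m. \<Sum>k<m. w ^ k * (\<zeta> ^ k) ^ j)"
    unfolding sum_distrib_right * ..
  also have "\<dots> = (\<Sum>k<m. w ^ k * (\<Sum>j<m. (\<zeta> ^ k) ^ j))"
    unfolding sum_distrib_left by (rule sum.swap)
  also have "\<dots> = (\<Sum>k<m. if k = 0 then of_nat m else 0)"
  proof (rule sum.cong[OF refl])
    fix k assume k: "k \<in> {..<m}"
    show "w ^ k * (\<Sum>j<m. (\<zeta> ^ k) ^ j) = (if k = 0 then of_nat m else 0)"
    proof (cases "k = 0")
      case False
      have "(\<zeta> ^ k) ^ m = (\<zeta> ^ m) ^ k" by (simp add: power_mult[symmetric] mult.commute)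
      then show ?thesis using False k \<zeta> by (subst geometric_sum) auto
    qed auto
  qed
  also have "\<dots> = of_nat m" using m by simp
  finally show ?thesis using w by (simp add: field_simps)
qed

lemma sin_nat_mult_eq_0_if:
  assumes "sin x = 0" shows "sin (real m * x) = (0::real)"
proof -
  obtain i where "x = of_int i * pi" using assms unfolding sin_zero_iff_int2 by auto
  then have "real m * x = of_int (int m * i) * pi" by simp
  then show ?thesis unfolding sin_zero_iff_int2 by blast
qed

text \<open>Isabelle's convention \<open>cot t = 0\<close> at the poles makes the identity hold for every \<open>y\<close>:
  at a pole, the remaining terms cancel in pairs.\<close>

lemma sum_cot_shifted:
  assumes m: "m > 0"
  shows "(\<Sum>j<m. cot (y + pi * real j / real m)) = real m * cot (real m * y)"
proof -
  define S where "S y = (\<Sum>j<m. cot (y + pi * real j / real m))" for y :: real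
  \<comment> \<open>Shifting by \<open>pi / m\<close> moves each node to the next; the last one
    returns to the first by the period pi of \<open>cot\<close>.\<close>
  have per: "S (y + pi / real m) = S y" for y
  proof -
    define f where "f j = cot (y + pi * real j / real m)" for j
    have "S (y + pi / real m) = (\<Sum>j<m. f (Suc j))"
      unfolding S_def f_def by (simp only: of_nat_Suc distrib_left mult_1_right add_divide_distrib add_ac)
    moreover have "f m = f 0" using m by (simp add: f_def cot_plus_pi)
    moreover have "(\<Sum>j<Suc m. f j) = f 0 + (\<Sum>j<m. f (Suc j))"
      by (rule sum.lessThan_Suc_shift)
    ultimately have "S (y + pi / real m) = (\<Sum>j<m. f j)" by simp
    then show ?thesis by (simp add: S_def f_def)
  qed
  have per_nat: "S (y + real k * (pi / real m)) = S y" for y k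
  proof (induction k)
    case (Suc k)
    have "y + real (Suc k) * (pi / real m) = (y + real k * (pi / real m)) + pi / real m"
      by (simp add: distrib_right add_divide_distrib)
    then show ?case using Suc by (simp only: per)
  qed simp
  have per_int: "S (y + of_int i * (pi / real m)) = S y" for y i
  proof (cases "i \<ge> 0")
    case True
    then show ?thesis using per_nat[of y "nat i"] by simp
  next
    case False
    then have "real (nat (- i)) = - of_int i" by simp
    then show ?thesis using per_nat[of "y + of_int i * (pi / real m)" "nat (- i)"] by simp
  qed
  have odd: "S (- y) = - S y" for y
  proof -
    have "S (- y) = (\<Sum>j<m. cot (- y + pi * real (m - Suc j) / real m))"
      unfolding S_def by (rule sum.nat_diff_reindex[symmetric])
    also have "\<dots> = (\<Sum>j<m. - cot ((y + pi / real m) + pi * real j / real m))"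
    proof (rule sum.cong[OF refl])
      fix j assume "j \<in> {..<m}"
      then have "- y + pi * real (m - Suc j) / real m = - ((y + pi / real m) + pi * real j / real m) + pi"
        using m by (simp add: of_nat_diff field_simps)
      then show "cot (- y + pi * real (m - Suc j) / real m) = - cot ((y + pi / real m) + pi * real j / real m)"
        by (simp only: cot_plus_pi cot_minus)
    qed
    also have "\<dots> = - S (y + pi / real m)" by (simp add: S_def sum_negf)
    finally show ?thesis by (simp add: per)
  qed
  show ?thesis
  proof (cases "sin (real m * y) = 0")
    \<comment> \<open>Here \<open>y\<close> is a multiple of \<open>pi / m\<close> and can be moved
      to 0, where the odd function \<open>S\<close> vanishes; the right-hand side is 0 by the value
      of \<open>cot\<close> at a pole.\<close>
    case True
    then obtain i where i: "real m * y = of_int i * pi" unfolding sin_zero_iff_int2 by auto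
    then have y: "y = 0 + of_int i * (pi / real m)" using m by (simp add: field_simps)
    have "S y = S 0" unfolding y by (rule per_int)
    also have "S 0 = 0" using odd[of 0] by simp
    finally show ?thesis using True by (simp add: S_def cot_def)
  next
    case False
    define w \<zeta> where "w = cis (2 * y)" and "\<zeta> = cis (2 * pi / real m)"
    have \<zeta>: "\<zeta> ^ k \<noteq> 1" if "0 < k" "k < m" for k
    proof
      assume "\<zeta> ^ k = 1"
      then have eq: "cis (2 * pi * real k / real m) = cis (2 * pi * real 0 / real m)"
        by (simp add: \<zeta>_def Complex.DeMoivre mult_ac)
      have inj: "inj_on (\<lambda>k. cis (2 * pi * real k / real m)) {..<m}"
        using Complex.bij_betw_roots_unity[OF m] by (rule bij_betw_imp_inj_on)
      have "k = 0" by (rule inj_onD[OF inj eq]) (use that in auto)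
      then show False using that by simp
    qed
    have "\<zeta> ^ m = 1" using m by (simp add: \<zeta>_def Complex.DeMoivre)
    have sn: "sin (y + pi * real j / real m) \<noteq> 0" if "j < m" for j
    proof
      assume "sin (y + pi * real j / real m) = 0"
      then have "sin (real m * (y + pi * real j / real m)) = 0" by (rule sin_nat_mult_eq_0_if)
      also have "real m * (y + pi * real j / real m) = real m * y + real j * pi"
        using m by (simp add: field_simps)
      finally show False using False by (simp add: sin_add)
    qed
    have wm: "w ^ m = cis (2 * (real m * y))" by (simp add: w_def Complex.DeMoivre mult_ac)
    have "w ^ m \<noteq> 1"
    proof
      assume "w ^ m = 1"
      then have "Re (cis (2 * (real m * y))) = 1" unfolding wm by simp
      then have "cos (2 * (real m * y)) = 1" by simp
      then show False using False unfolding cos_double_sin by simp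
    qed
    have "complex_of_real (S y) = (\<Sum>j<m. \<i> * (1 + 2 / (w * \<zeta> ^ j - 1)))"
      unfolding S_def of_real_sum
    proof (rule sum.cong[OF refl])
      fix j assume "j \<in> {..<m}"
      then have "complex_of_real (cot (y + pi * real j / real m)) =
          \<i> * (1 + 2 / (cis (2 * (y + pi * real j / real m)) - 1))"
        by (intro cot_cis sn) auto
      also have "cis (2 * (y + pi * real j / real m)) = w * \<zeta> ^ j"
        by (simp add: w_def \<zeta>_def Complex.DeMoivre cis_mult algebra_simps)
      finally show "complex_of_real (cot (y + pi * real j / real m)) = \<i> * (1 + 2 / (w * \<zeta> ^ j - 1))" .
    qed
    also have "\<dots> = \<i> * (of_nat m + 2 * (\<Sum>j<m. 1 / (w * \<zeta> ^ j - 1)))"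
      by (simp add: sum_distrib_left[symmetric] sum.distrib sum_distrib_left)
    also have "\<dots> = of_nat m * (\<i> * (1 + 2 / (w ^ m - 1)))"
      using sum_inverse_rotated_minus_1[OF m \<zeta> \<open>\<zeta> ^ m = 1\<close> \<open>w ^ m \<noteq> 1\<close>]
      by (simp add: algebra_simps)
    also have "\<i> * (1 + 2 / (w ^ m - 1)) = complex_of_real (cot (real m * y))"
      unfolding wm by (rule cot_cis[OF False, symmetric])
    finally have "complex_of_real (S y) = complex_of_real (real m * cot (real m * y))" by simp
    then show ?thesis unfolding of_real_eq_iff by (simp add: S_def)
  qed
qed

text \<open>The joint pull of a mirror pair at \<open>t\<close> and \<open>- t\<close> on a point at
  \<open>s\<close>. With \<open>u, v\<close> the half difference and half sum, cos t - cos s = 2 sin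
  u sin v; so apart from the factor \<open>sin s\<close> only cosines remain, which links the circle
  to the zeros on the interval.\<close>

lemma cot_half_diff_add:
  fixes s t :: real
  assumes "cos s \<noteq> cos t"
  shows "cot ((s - t) / 2) + cot ((s + t) / 2) = 2 * sin s / (cos t - cos s)"
proof -
  define u v where "u = (s - t) / 2" and "v = (s + t) / 2"
  have st: "s = u + v" "t = v - u" by (auto simp: u_def v_def field_simps)
  have e: "cos t - cos s = 2 * (sin u * sin v)" unfolding st by (simp add: cos_add cos_diff)
  then have "sin u \<noteq> 0" "sin v \<noteq> 0" using assms by auto
  then have "cot u + cot v = sin s / (sin u * sin v)"
    unfolding st by (simp add: cot_def sin_add field_simps)
  then show ?thesis unfolding u_def[symmetric] v_def[symmetric] e by simp
qed

text \<open>The pulls of unit charges at the angles 0 and pi. Multiplied by \<open>sin t\<close>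
  they become 1 + x and -(1 - x) with x = cos t, the building blocks of the first-order coefficient
  in the Jacobi equation.\<close>

lemma cot_half_mult_sin: 
  fixes t :: real
  assumes "sin t \<noteq> 0"
  shows "cot (t / 2) * sin t = 1 + cos t" "cot ((t - pi) / 2) * sin t = - (1 - cos t)"
proof -
  define u where "u = t / 2"
  have t: "t = 2 * u" by (simp add: u_def)
  have nz: "sin u \<noteq> 0" "cos u \<noteq> 0" using assms unfolding t sin_double by auto
  have c: "cos u * cos u = 1 - sin u * sin u"
    using sin_cos_squared_add3[of u] by linarith
  show "cot (t / 2) * sin t = 1 + cos t"
    unfolding t cos_double_cos using nz by (simp add: sin_double cot_def power2_eq_square)
  have "cot (u - pi / 2) = - (sin u / cos u)"
    by (simp add: cot_def sin_diff cos_diff)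
  then show "cot ((t - pi) / 2) * sin t = - (1 - cos t)"
    unfolding t cos_double_sin using nz by (simp add: sin_double power2_eq_square diff_divide_distrib)
qed

section \<open>Equilibria are unique maxima\<close>

text \<open>All \<open>2m(n + 1)\<close> points in increasing order: position \<open>b(n + 1)\<close> holds the \<open>b\<close>-th of the points
  \<open>\<phi>\<^sub>1, \<psi>\<^sub>1, \<phi>\<^sub>2, \<psi>\<^sub>2, \<dots>\<close> (counting from 0), and it is followed by the \<open>n\<close> points \<open>\<theta>\<close> of block \<open>b\<close>.\<close>

fun charge :: "nat \<Rightarrow> real \<Rightarrow> real \<Rightarrow> nat \<Rightarrow> real" where
  "charge n p q r = (if r mod (n + 1) = 0 then if even (r div (n + 1)) then p else q else 1)"

fun merged :: "nat \<Rightarrow> config \<Rightarrow> nat \<Rightarrow> real" where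
  "merged n (\<phi>, \<psi>, \<theta>) r =
     (let b = r div (n + 1); i = r mod (n + 1)
      in if i = 0 then if even b then \<phi> (b div 2 + 1) else \<psi> (b div 2 + 1)
         else \<theta> (b * n + i))"

declare charge.simps [simp del] merged.simps [simp del]

lemma merged_wall [simp]: 
  "merged n (\<phi>, \<psi>, \<theta>) (b * (n + 1)) = (if even b then \<phi> (b div 2 + 1) else \<psi> (b div 2 + 1))"
  "charge n p q (b * (n + 1)) = (if even b then p else q)"
proof -
  have "b * (n + 1) div (n + 1) = b" "b * (n + 1) mod (n + 1) = 0"
    by (rule nonzero_mult_div_cancel_right, simp) (rule mod_mult_self2_is_0)
  then show "merged n (\<phi>, \<psi>, \<theta>) (b * (n + 1)) = (if even b then \<phi> (b div 2 + 1) else \<psi> (b div 2 + 1))"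
    "charge n p q (b * (n + 1)) = (if even b then p else q)"
    by (simp_all only: merged.simps charge.simps Let_def refl if_True)
qed

lemma merged_inner [simp]:
  assumes "0 < i" "i \<le> n"
  shows "merged n (\<phi>, \<psi>, \<theta>) (b * (n + 1) + i) = \<theta> (b * n + i)"
    and "charge n p q (b * (n + 1) + i) = 1"
proof -
  have "(b * (n + 1) + i) div (n + 1) = b" "(b * (n + 1) + i) mod (n + 1) = i"
    using assms by (simp_all only: div_mult_self3 mod_mult_self3 mult.commute) auto
  then show "merged n (\<phi>, \<psi>, \<theta>) (b * (n + 1) + i) = \<theta> (b * n + i)"
    "charge n p q (b * (n + 1) + i) = 1"
    using assms by (simp_all add: merged.simps charge.simps Let_def del: One_nat_def)
qed

section \<open>Block indices and sums over the merged sequence\<close>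

lemma block_index:
  fixes k N n :: nat
  assumes "k \<in> {1..N * n}"
  obtains b i where "b < N" "i \<in> {1..n}" "k = b * n + i"
proof
  have n: "n > 0" using assms by (cases n) auto
  \<comment> \<open>Offsets within a block run over \<open>1..n\<close>, hence the shift by one
    before dividing.\<close>
  define b i where "b = (k - 1) div n" and "i = (k - 1) mod n + 1"
  show "b < N" unfolding b_def using assms by (intro less_mult_imp_div_less) auto
  show "i \<in> {1..n}" using n by (auto simp: i_def Suc_le_eq)
  have "b * n + i = ((k - 1) div n * n + (k - 1) mod n) + 1" by (simp add: b_def i_def)
  then show "k = b * n + i" using assms unfolding div_mult_mod_eq by simp
qed

lemma block_index_bound:
  assumes "b < N" "i \<le> n"
  shows "b * n + i \<le> N * (n :: nat)"
proof -
  have "b * n + i \<le> (b + 1) * n" using assms by simp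
  also have "\<dots> \<le> N * n" using assms by (intro mult_le_mono1) auto
  finally show ?thesis .
qed

lemma block_index_bound':
  assumes "b < N" "i \<le> (n :: nat)"
  shows "b * (n + 1) + i < N * (n + 1)"
proof -
  have "b * (n + 1) + i < (b + 1) * (n + 1)" using assms by simp
  also have "\<dots> \<le> N * (n + 1)" using assms by (intro mult_le_mono1) auto
  finally show ?thesis .
qed

lemma sum_even_odd: "(\<Sum>b<2 * m. f b) = (\<Sum>j<m. f (2 * j)) + (\<Sum>j<m. f (2 * j + 1 :: nat) :: 'a::comm_monoid_add)"
  by (induction m) (auto simp: add_ac)

lemma sum_upto_blocks:
  fixes f :: "nat \<Rightarrow> 'a::comm_monoid_add"
  shows "(\<Sum>k=1..N * n. f k) = (\<Sum>b<N. \<Sum>i=1..n. f (b * n + i))"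
proof -
  have "(\<Sum>b<N. \<Sum>i=1..n. f (b * n + i)) = (\<Sum>b<N. \<Sum>k=b * n..<b * n + n. f (Suc k))"
  proof (rule sum.cong[OF refl])
    fix b
    have "(\<Sum>i=1..n. f (b * n + i)) = (\<Sum>i=0..<n. f (b * n + Suc i))"
      by (rule sum.reindex_bij_witness[of _ Suc "\<lambda>i. i - 1"]) auto
    also have "\<dots> = (\<Sum>k=b * n..<b * n + n. f (Suc k))"
      by (rule sum.reindex_bij_witness[of _ "\<lambda>k. k - b * n" "\<lambda>i. b * n + i"]) auto
    finally show "(\<Sum>i=1..n. f (b * n + i)) = (\<Sum>k=b * n..<b * n + n. f (Suc k))" .
  qed
  also have "\<dots> = (\<Sum>k<N * n. f (Suc k))"
    by (rule sum.nat_group)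
  also have "\<dots> = (\<Sum>k=1..N * n. f k)"
    by (rule sum.reindex_bij_witness[of _ "\<lambda>i. i - 1" Suc]) auto
  finally show ?thesis ..
qed

text \<open>\<open>F\<close> sees both charge and position of a point, so this one splitting by
  kinds of points serves the energy as well as the forces.\<close>

lemma sum_merged:
  fixes F :: "real \<Rightarrow> real \<Rightarrow> real"
  shows "(\<Sum>r<2 * m * (n + 1). F (charge n p q r) (merged n (\<phi>, \<psi>, \<theta>) r)) =
     (\<Sum>j=1..m. F p (\<phi> j)) + (\<Sum>j=1..m. F q (\<psi> j)) + (\<Sum>k=1..2 * m * n. F 1 (\<theta> k))"
proof -
  define G where "G r = F (charge n p q r) (merged n (\<phi>, \<psi>, \<theta>) r)" for r
  have shift: "(\<Sum>j<m. h (j + 1)) = (\<Sum>j=1..m. h j)" for h :: "nat \<Rightarrow> real"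
    by (rule sum.reindex_bij_witness[of _ "\<lambda>i. i - 1" Suc]) auto
  have wall: "(\<Sum>b<2 * m. G (b * (n + 1))) = (\<Sum>j=1..m. F p (\<phi> j)) + (\<Sum>j=1..m. F q (\<psi> j))"
    unfolding sum_even_odd G_def merged_wall shift[symmetric] by simp
  have "(\<Sum>r<2 * m * (n + 1). G r) = (\<Sum>b<2 * m. \<Sum>r=b * (n + 1)..<b * (n + 1) + (n + 1). G r)"
    by (rule sum.nat_group[symmetric])
  also have "\<dots> = (\<Sum>b<2 * m. G (b * (n + 1)) + (\<Sum>i=1..n. F 1 (\<theta> (b * n + i))))"
  proof (rule sum.cong[OF refl])
    fix b
    have "(\<Sum>r=b * (n + 1)..<b * (n + 1) + (n + 1). G r) = (\<Sum>i=0..n. G (b * (n + 1) + i))"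
      by (rule sum.reindex_bij_witness[of _ "\<lambda>i. b * (n + 1) + i" "\<lambda>k. k - b * (n + 1)"]) auto
    also have "\<dots> = G (b * (n + 1)) + (\<Sum>i=1..n. G (b * (n + 1) + i))"
      by (subst sum.atLeast_Suc_atMost) auto
    also have "(\<Sum>i=1..n. G (b * (n + 1) + i)) = (\<Sum>i=1..n. F 1 (\<theta> (b * n + i)))"
    proof (rule sum.cong[OF refl])
      fix i assume "i \<in> {1..n}"
      then have "0 < i" "i \<le> n" by auto
      then show "G (b * (n + 1) + i) = F 1 (\<theta> (b * n + i))"
        unfolding G_def by (simp only: merged_inner)
    qed
    finally show "(\<Sum>r=b * (n + 1)..<b * (n + 1) + (n + 1). G r) = G (b * (n + 1)) + (\<Sum>i=1..n. F 1 (\<theta> (b * n + i)))" .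
  qed
  also have "\<dots> = (\<Sum>b<2 * m. G (b * (n + 1))) + (\<Sum>b<2 * m. \<Sum>i=1..n. F 1 (\<theta> (b * n + i)))"
    by (rule sum.distrib)
  also have "\<dots> = (\<Sum>j=1..m. F p (\<phi> j)) + (\<Sum>j=1..m. F q (\<psi> j)) + (\<Sum>k=1..2 * m * n. F 1 (\<theta> k))"
    unfolding wall sum_upto_blocks ..
  finally show ?thesis by (simp only: G_def)
qed

lemma sum_symmetric_square:
  fixes g :: "nat \<Rightarrow> nat \<Rightarrow> real"
  assumes "\<And>j k. g j k = g k j" "\<And>j. g j j = 0"
  shows "(\<Sum>j=1..M. \<Sum>k=1..M. g j k) = 2 * (\<Sum>j=1..M. \<Sum>k=1..<j. g j k)"
proof (induction M)
  case (Suc M)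
  have "(\<Sum>j=1..Suc M. \<Sum>k=1..Suc M. g j k) = 
     (\<Sum>j=1..M. \<Sum>k=1..M. g j k) + (\<Sum>j=1..M. g j (Suc M)) + (\<Sum>k=1..M. g (Suc M) k)"
    by (simp add: sum.distrib assms(2))
  also have "(\<Sum>j=1..M. g j (Suc M)) = (\<Sum>k=1..M. g (Suc M) k)"
    using assms(1) by simp
  finally show ?case using Suc by (simp add: atLeastLessThanSuc_atLeastAtMost)
qed simp

text \<open>The full double sum counts each pair twice, and its diagonal is 0 because
  \<open>ln 0 = 0\<close>. The products of charges reproduce the six coefficients p, q, 1, p^2, q^2
  and pq.\<close>

lemma hamiltonian_merged:
  defines "K \<equiv> \<lambda>x y. ln (cmod (cis x - cis y))"
  shows "hamiltonian m n p q c =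
     (\<Sum>r<2 * m * (n + 1). \<Sum>s<2 * m * (n + 1).
        charge n p q r * charge n p q s * K (merged n c r) (merged n c s)) / 2"
proof -
  obtain \<phi> \<psi> \<theta> where c: "c = (\<phi>, \<psi>, \<theta>)" by (cases c)
  have sym: "K x y = K y x" for x y by (simp add: K_def norm_minus_commute)
  have diag: "K x x = 0" for x by (simp add: K_def)
  define D where "D M N f g = (\<Sum>j=1..M. \<Sum>k=1..N. K (f j) (g k))" for M N :: nat and f g
  have Dsym: "D M N f g = D N M g f" for M N f g
    unfolding D_def by (subst sum.swap) (simp add: sym)
  have tri: "D M M f f = 2 * (\<Sum>j=1..M. \<Sum>k=1..<j. K (f j) (f k))" for M f
    unfolding D_def by (rule sum_symmetric_square) (auto simp: sym diag)
  have inner: "(\<Sum>s<2 * m * (n + 1). w * charge n p q s * K x (merged n c s)) =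
     w * (p * (\<Sum>j=1..m. K x (\<phi> j)) + q * (\<Sum>j=1..m. K x (\<psi> j)) + (\<Sum>k=1..2 * m * n. K x (\<theta> k)))" for w x
    unfolding c using sum_merged[where F = "\<lambda>v y. w * v * K x y" and \<phi> = \<phi> and \<psi> = \<psi> and \<theta> = \<theta>]
    by (simp add: sum_distrib_left distrib_left mult.assoc)
  have "(\<Sum>r<2 * m * (n + 1). \<Sum>s<2 * m * (n + 1).
        charge n p q r * charge n p q s * K (merged n c r) (merged n c s)) = 
     p * (p * D m m \<phi> \<phi> + q * D m m \<phi> \<psi> + D m (2 * m * n) \<phi> \<theta>) +
     q * (p * D m m \<psi> \<phi> + q * D m m \<psi> \<psi> + D m (2 * m * n) \<psi> \<theta>) +
     (p * D (2 * m * n) m \<theta> \<phi> + q * D (2 * m * n) m \<theta> \<psi> + D (2 * m * n) (2 * m * n) \<theta> \<theta>)"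
    unfolding inner unfolding c
    by (subst sum_merged[where F = "\<lambda>w x. w * (p * (\<Sum>j=1..m. K x (\<phi> j)) +
       q * (\<Sum>j=1..m. K x (\<psi> j)) + (\<Sum>k=1..2 * m * n. K x (\<theta> k)))"])
       (simp only: D_def sum.distrib sum_distrib_left[symmetric] mult_1_left)
  also have "\<dots> = 2 * hamiltonian m n p q c"
    unfolding Dsym[of "2 * m * n" m] Dsym[of m m \<psi> \<phi>] tri
    unfolding hamiltonian_def c prod.case D_def K_def[symmetric]
    by (simp add: algebra_simps power2_eq_square K_def)
  finally show ?thesis by simp
qed

text \<open>Each inequality in \<open>config_space\<close> compares two consecutive positions, so
  only the indices have to be matched: block \<open>2 * (j - 1)\<close> is the arc from \<phi>_j to
  \<psi>_j, and block \<open>2 * j - 1\<close> is the arc that follows.\<close>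

lemma config_space_chain:
  assumes c: "c \<in> config_space m n" and n: "n \<ge> 1" and r: "r < 2 * m * (n + 1)"
  shows "merged n c r < (if Suc r = 2 * m * (n + 1) then 2 * pi else merged n c (Suc r))"
proof -
  obtain \<phi> \<psi> \<theta> where ceq: "c = (\<phi>, \<psi>, \<theta>)" by (cases c)
  define b i where "b = r div (n + 1)" and "i = r mod (n + 1)"
  have req: "r = b * (n + 1) + i" unfolding b_def i_def by (rule div_mult_mod_eq[symmetric])
  have i: "i \<le> n" unfolding i_def using mod_less_divisor[of "n + 1" r] by simp
  have b: "b < 2 * m" using r unfolding b_def by (simp only: less_mult_imp_div_less)
  define j where "j = b div 2 + 1"
  have j: "j \<in> {1..m}" using b by (auto simp: j_def)
  have C: "\<phi> j < \<theta> (2*(j-1)*n + 1)"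
     "\<And>i. i\<in>{1..<n} \<Longrightarrow> \<theta> (2*(j-1)*n + i) < \<theta> (2*(j-1)*n + i + 1)"
     "\<theta> ((2*j-1)*n) < \<psi> j" "\<psi> j < \<theta> ((2*j-1)*n + 1)"
     "\<And>i. i\<in>{1..<n} \<Longrightarrow> \<theta> ((2*j-1)*n + i) < \<theta> ((2*j-1)*n + i + 1)"
     "\<theta> (2*j*n) < (if j = m then 2 * pi else \<phi> (j+1))"
    using c j unfolding ceq config_space_def by auto
  have be: "b = 2 * (j - 1)" if "even b" using that by (simp add: j_def)
  have bo: "b = 2 * j - 1" if "odd b" using that by (auto simp: j_def elim!: oddE)
  have last: "Suc r = 2 * m * (n + 1) \<longleftrightarrow> i = n \<and> b = 2 * m - 1"
  proof
    assume *: "Suc r = 2 * m * (n + 1)"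
    have "i = n"
    proof (rule ccontr)
      assume "i \<noteq> n"
      then have "Suc i < n + 1" using i by simp
      then have "Suc r mod (n + 1) = Suc i" unfolding req by (metis add_Suc_right mod_less mod_mult_self3)
      moreover have "Suc r mod (n + 1) = 0" unfolding * by (rule mod_mult_self2_is_0)
      ultimately show False by simp
    qed
    then have "(b + 1) * (n + 1) = 2 * m * (n + 1)" using * unfolding req by simp
    then have "b + 1 = 2 * m" by (simp only: mult_cancel2) simp
    then show "i = n \<and> b = 2 * m - 1" using \<open>i = n\<close> by simp
  next
    assume *: "i = n \<and> b = 2 * m - 1"
    then have "b + 1 = 2 * m" using b by simp
    have "Suc r = (b + 1) * (n + 1)" unfolding req using * by simp
    then show "Suc r = 2 * m * (n + 1)" unfolding \<open>b + 1 = 2 * m\<close> .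
  qed
  \<comment> \<open>A wall before a free point, two free points of one block, or the last free point
    of a block before a wall or before 2 pi. As \<open>n \<ge> 1\<close>, no two walls are
    adjacent.\<close>
  consider "i = 0" | "0 < i" "i < n" | "i = n" "0 < i" using i n by linarith
  then show ?thesis
  proof cases
    case 1
    have "Suc r = b * (n + 1) + 1" using 1 by (simp add: req)
    then have s: "merged n c (Suc r) = \<theta> (b * n + 1)" using n by (simp only: ceq merged_inner)
    have "r = b * (n + 1)" using 1 by (simp add: req)
    then have "merged n c r = (if even b then \<phi> j else \<psi> j)" unfolding j_def ceq by (simp only: merged_wall)
    moreover have "\<not> Suc r = 2 * m * (n + 1)" unfolding last using 1 n by simp
    ultimately show ?thesis using s C(1,4) be bo by (cases "even b") auto
  next
    case 2
    have "Suc r = b * (n + 1) + (i + 1)" by (simp add: req)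
    then have s: "merged n c (Suc r) = \<theta> (b * n + (i + 1))" using 2 by (simp only: ceq merged_inner)
    have "merged n c r = \<theta> (b * n + i)" using 2 by (simp only: req ceq merged_inner)
    moreover have "\<not> Suc r = 2 * m * (n + 1)" unfolding last using 2 by simp
    ultimately show ?thesis using s C(2,5)[of i] be bo 2 by (cases "even b") (auto simp: add.assoc)
  next
    case 3
    have "Suc r = (b + 1) * (n + 1)" using 3 by (simp add: req)
    then have s: "merged n c (Suc r) = (if even (b + 1) then \<phi> ((b + 1) div 2 + 1) else \<psi> ((b + 1) div 2 + 1))"
      unfolding ceq by (simp only: merged_wall)
    have "merged n c r = \<theta> (b * n + n)" using 3 by (simp only: req ceq merged_inner)
    also have "b * n + n = (b + 1) * n" by simp
    finally have t: "merged n c r = \<theta> ((b + 1) * n)" .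
    show ?thesis
    proof (cases "even b")
      case True
      then have "b + 1 = 2 * j - 1" "(b + 1) div 2 + 1 = j" using j by (auto simp: j_def)
      moreover have "\<not> Suc r = 2 * m * (n + 1)" unfolding last using True b by auto
      ultimately show ?thesis using s t C(3) True by auto
    next
      case False
      then have "b + 1 = 2 * j" using bo by (auto simp: j_def)
      moreover have "(Suc r = 2 * m * (n + 1)) = (j = m)" unfolding last using 3 \<open>b + 1 = 2 * j\<close> j by auto
      ultimately show ?thesis using s t C(6) False by auto
    qed
  qed
qed

lemma merged_0: "c \<in> config_space m n \<Longrightarrow> merged n c 0 = 0"
  using merged_wall(1)[of n _ _ _ 0] by (cases c) (auto simp: config_space_def)

lemma config_space_mono:
  assumes c: "c \<in> config_space m n" and n: "n \<ge> 1" and s: "s < 2 * m * (n + 1)"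
  shows "r < s \<Longrightarrow> merged n c r < merged n c s" and "merged n c s < 2 * pi"
proof -
  have mono: "merged n c r < merged n c s" if "r < s" "s < 2 * m * (n + 1)" for r s
    using that
  proof (induction s)
    case (Suc s)
    have "merged n c s < merged n c (Suc s)" using config_space_chain[OF c n, of s] Suc.prems by auto
    then show ?case using Suc by (cases "r = s") auto
  qed auto
  then show "r < s \<Longrightarrow> merged n c r < merged n c s" using s by blast
  have N: "2 * m * (n + 1) - 1 < 2 * m * (n + 1)" "Suc (2 * m * (n + 1) - 1) = 2 * m * (n + 1)" using s by auto
  have last: "merged n c (2 * m * (n + 1) - 1) < 2 * pi"
    using config_space_chain[OF c n N(1)] N(2) by simp
  show "merged n c s < 2 * pi"
    using mono[of s "2 * m * (n + 1) - 1"] N s last by (cases "s = 2 * m * (n + 1) - 1") auto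
qed

text \<open>The merged sequence shows the tuples only on their index ranges; outside them,
  membership in \<open>config_space\<close> makes both \<open>undefined\<close>.\<close>

lemma merged_inject:
  assumes c: "c \<in> config_space m n" and d: "d \<in> config_space m n" and n: "n \<ge> 1"
    and eq: "\<And>r. r < 2 * m * (n + 1) \<Longrightarrow> merged n c r = merged n d r"
  shows "c = d"
proof -
  obtain \<phi> \<psi> \<theta> where ceq: "c = (\<phi>, \<psi>, \<theta>)" by (cases c)
  obtain \<phi>' \<psi>' \<theta>' where deq: "d = (\<phi>', \<psi>', \<theta>')" by (cases d)
  have ext: "\<phi> \<in> extensional {1..m}" "\<phi>' \<in> extensional {1..m}" "\<psi> \<in> extensional {1..m}" "\<psi>' \<in> extensional {1..m}"
     "\<theta> \<in> extensional {1..2*m*n}" "\<theta>' \<in> extensional {1..2*m*n}"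
    using c d unfolding ceq deq config_space_def by (auto simp: PiE_def)
  have "\<phi> j = \<phi>' j" if "j \<in> {1..m}" for j
  proof -
    have "2 * (j - 1) < 2 * m" using that by auto
    then have "merged n c (2 * (j - 1) * (n + 1)) = merged n d (2 * (j - 1) * (n + 1))"
      using eq block_index_bound'[of "2 * (j - 1)" "2 * m" 0 n] by simp
    then show ?thesis using that unfolding ceq deq merged_wall by simp
  qed
  moreover have "\<psi> j = \<psi>' j" if "j \<in> {1..m}" for j
  proof -
    have "2 * (j - 1) + 1 < 2 * m" using that by auto
    then have "merged n c ((2 * (j - 1) + 1) * (n + 1)) = merged n d ((2 * (j - 1) + 1) * (n + 1))"
      using eq block_index_bound'[of "2 * (j - 1) + 1" "2 * m" 0 n] by simp
    then show ?thesis using that unfolding ceq deq merged_wall by simp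
  qed
  moreover have "\<theta> k = \<theta>' k" if "k \<in> {1..2*m*n}" for k
  proof -
    from that obtain b i where bi: "b < 2 * m" "i \<in> {1..n}" and k: "k = b * n + i" by (rule block_index)
    then have i: "0 < i" "i \<le> n" by auto
    show ?thesis using eq[OF block_index_bound'[OF bi(1) i(2)]] unfolding ceq deq merged_inner[OF i] k .
  qed
  ultimately show ?thesis unfolding ceq deq using ext by (auto intro!: extensionalityI)
qed

text \<open>Log-sine is strictly concave on \<open>(0, \<pi>)\<close>, so each pair interaction lies below its tangent
  at an equilibrium \<open>c\<close>; summed over all pairs, the first-order terms are the forces, which vanish.\<close>

lemma equilibrium_unique_max:
  assumes c: "c \<in> config_space m n" and d: "d \<in> config_space m n" and n: "n \<ge> 1" and "m \<ge> 1"
    and pq: "p > 0" "q > 0"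
    and force: "\<And>r. r < 2 * m * (n + 1) \<Longrightarrow>
      (\<Sum>s<2 * m * (n + 1). charge n p q s * cot ((merged n c r - merged n c s) / 2)) = 0"
    and "d \<noteq> c"
  shows "hamiltonian m n p q d < hamiltonian m n p q c"
proof -
  define N where "N = 2 * m * (n + 1)"
  define X Y w where "X = merged n c" and "Y = merged n d" and "w = charge n p q"
  define K where "K x y = ln (cmod (cis x - cis y))" for x y
  define T where "T r s = cot ((X r - X s) / 2) * ((Y r - Y s) - (X r - X s)) / 2" for r s
  have w: "w r > 0" for r using pq by (simp add: w_def charge.simps)
  have sym: "K x y = K y x" for x y by (simp add: K_def norm_minus_commute)
  have gap: "0 < Z s - Z r" "Z s - Z r < 2 * pi" 
    if Z: "Z = X \<or> Z = Y" and "r < s" "s < N" for Z r s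
  proof -
    obtain e where e: "e \<in> config_space m n" "Z = merged n e" using Z c d X_def Y_def by metis
    have "merged n e 0 \<le> merged n e r" 
      using config_space_mono(1)[OF e(1) n, of r 0] that by (cases "r = 0") (auto simp: N_def)
    then show "0 < Z s - Z r" "Z s - Z r < 2 * pi"
      using config_space_mono[OF e(1) n, of s] that merged_0[OF e(1)] unfolding e(2) N_def by (auto simp: N_def)
  qed
  have Tsym: "T r s = T s r" for r s
  proof -
    have "(X r - X s) / 2 = - ((X s - X r) / 2)" by (simp add: diff_divide_distrib)
    then have "cot ((X r - X s) / 2) = - cot ((X s - X r) / 2)" by (simp only: cot_minus)
    then show ?thesis unfolding T_def by (simp add: algebra_simps)
  qed
  have tangent_less: "K (Y s) (Y r) \<le> K (X s) (X r) + T s r \<and>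
      (Y s - Y r \<noteq> X s - X r \<longrightarrow> K (Y s) (Y r) < K (X s) (X r) + T s r)" if "r < s" "s < N" for r s
    unfolding K_def T_def using gap[OF _ that] ln_cmod_cis_diff_tangent by auto
  have tangent: "K (Y r) (Y s) \<le> K (X r) (X s) + T r s \<and>
      (Y r - Y s \<noteq> X r - X s \<longrightarrow> K (Y r) (Y s) < K (X r) (X s) + T r s)" if "r < N" "s < N" for r s
  proof (cases r s rule: linorder_cases)
    case less
    then show ?thesis using tangent_less[of r s] that sym Tsym[of r s]
      by (metis minus_diff_eq)
  next
    case equal
    then show ?thesis by (simp add: K_def T_def)
  next
    case greater
    then show ?thesis using tangent_less[of s r] that by auto
  qed
  have "\<exists>r<N. Y r \<noteq> X r"
    using merged_inject[OF d c n] \<open>d \<noteq> c\<close> unfolding N_def X_def Y_def by auto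
  then obtain r0 where r0: "r0 < N" "Y r0 \<noteq> X r0" by auto
  \<comment> \<open>Both configurations are anchored at 0, so the pair \<open>(r0, 0)\<close> has
    different gaps in \<open>X\<close> and \<open>Y\<close>; this pair supplies the strict
    inequality.\<close>
  have zero: "X 0 = 0" "Y 0 = 0" "0 < N" using merged_0 c d r0 unfolding X_def Y_def by auto
  have "(\<Sum>r<N. \<Sum>s<N. w r * w s * K (Y r) (Y s)) < (\<Sum>r<N. \<Sum>s<N. w r * w s * (K (X r) (X s) + T r s))"
  proof (rule sum_strict_mono_ex1)
    show "\<forall>r\<in>{..<N}. (\<Sum>s<N. w r * w s * K (Y r) (Y s)) \<le> (\<Sum>s<N. w r * w s * (K (X r) (X s) + T r s))"
      using tangent w by (intro ballI sum_mono mult_left_mono) (auto simp: less_imp_le)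
    have "(\<Sum>s<N. w r0 * w s * K (Y r0) (Y s)) < (\<Sum>s<N. w r0 * w s * (K (X r0) (X s) + T r0 s))"
    proof (rule sum_strict_mono_ex1)
      show "\<forall>s\<in>{..<N}. w r0 * w s * K (Y r0) (Y s) \<le> w r0 * w s * (K (X r0) (X s) + T r0 s)"
        using tangent r0 w by (intro ballI mult_left_mono) (auto simp: less_imp_le)
      have "w r0 * w 0 * K (Y r0) (Y 0) < w r0 * w 0 * (K (X r0) (X 0) + T r0 0)"
        using tangent[of r0 0] r0 zero w by (intro mult_strict_left_mono) auto
      then show "\<exists>s\<in>{..<N}. w r0 * w s * K (Y r0) (Y s) < w r0 * w s * (K (X r0) (X s) + T r0 s)"
        using zero(3) by (intro bexI[of _ 0]) auto
    qed auto
    then show "\<exists>r\<in>{..<N}. (\<Sum>s<N. w r * w s * K (Y r) (Y s)) < (\<Sum>s<N. w r * w s * (K (X r) (X s) + T r s))"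
      using r0(1) by (intro bexI[of _ r0]) auto
  qed auto
  also have "\<dots> = (\<Sum>r<N. \<Sum>s<N. w r * w s * K (X r) (X s)) + (\<Sum>r<N. \<Sum>s<N. w r * w s * T r s)"
    by (simp add: distrib_left sum.distrib)
  also have "(\<Sum>r<N. \<Sum>s<N. w r * w s * T r s) = 0"
  proof -
    \<comment> \<open>\<open>U r s\<close> is the share of the first-order term due to moving point
      \<open>r\<close>. As \<open>cot\<close> is odd, \<open>T\<close> splits into
      \<open>U r s + U s r\<close>, and for fixed \<open>r\<close> the sum over \<open>s\<close> is
      a multiple of the force at \<open>r\<close>.\<close>
    define U where "U r s = w r * w s * cot ((X r - X s) / 2) * (Y r - X r) / 2" for r s
    have T: "w r * w s * T r s = U r s + U s r" for r s
    proof -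
      have "(X s - X r) / 2 = - ((X r - X s) / 2)" by (simp add: diff_divide_distrib)
      then have "cot ((X s - X r) / 2) = - cot ((X r - X s) / 2)" by (simp only: cot_minus)
      then show ?thesis unfolding T_def U_def by (simp add: field_simps)
    qed
    have U: "(\<Sum>r<N. \<Sum>s<N. U r s) = 0"
    proof (rule sum.neutral, rule ballI)
      fix r assume "r \<in> {..<N}"
      then have "(\<Sum>s<N. w s * cot ((X r - X s) / 2)) = 0"
        using force unfolding N_def X_def w_def by simp
      then have "0 = w r * (Y r - X r) / 2 * (\<Sum>s<N. w s * cot ((X r - X s) / 2))" by simp
      also have "\<dots> = (\<Sum>s<N. U r s)" unfolding sum_distrib_left U_def by (simp add: mult_ac)
      finally show "(\<Sum>s<N. U r s) = 0" ..
    qed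
    moreover have "(\<Sum>r<N. \<Sum>s<N. U s r) = (\<Sum>r<N. \<Sum>s<N. U r s)" by (rule sum.swap)
    ultimately show ?thesis by (simp add: T sum.distrib)
  qed
  finally show ?thesis
    unfolding hamiltonian_merged K_def N_def X_def Y_def w_def by simp
qed

section \<open>Uniqueness and the zeros on the circle\<close>

lemma cis_inj_Ico:
  assumes "cis x = cis y" "0 \<le> x" "x < 2 * pi" "0 \<le> y" "y < 2 * pi"
  shows "x = y"
proof -
  have "2 * \<bar>sin ((x - y) / 2)\<bar> = 0" using cmod_cis_diff[of x y] assms(1) by simp
  then have "sin ((x - y) / 2) = 0" by simp
  then have "(x - y) / 2 = 0" using assms sin_eq_0_pi[of "(x - y) / 2"] by simp
  then show ?thesis by simp
qed

lemma strict_mono_same_image: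
  fixes f g :: "nat \<Rightarrow> 'a::linorder"
  assumes "strict_mono_on {1..N} f" "strict_mono_on {1..N} g" "f ` {1..N} = g ` {1..N}" "j \<in> {1..N}"
  shows "f j = g j"
proof -
  have range: "set [1..<Suc N] = {1..N}" by (simp only: set_upt atLeastLessThanSuc_atLeastAtMost)
  have sorted: "sorted_wrt (<) (map h [1..<Suc N])" if "strict_mono_on {1..N} h" for h :: "nat \<Rightarrow> 'a"
    unfolding sorted_wrt_map
  proof (rule sorted_wrt_mono_rel[OF _ sorted_wrt_upt])
    fix x y assume "x \<in> set [1..<Suc N]" "y \<in> set [1..<Suc N]" "x < y"
    then show "h x < h y" unfolding range by (rule strict_mono_onD[OF that])
  qed
  have "set (map f [1..<Suc N]) = set (map g [1..<Suc N])"
    unfolding set_map range by (rule assms(3))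
  then have "map f [1..<Suc N] = map g [1..<Suc N]"
    using strict_sorted_equal[OF sorted[OF assms(1)] sorted[OF assms(2)]] by (simp only:)
  then show ?thesis using assms(4) unfolding map_eq_conv range by blast
qed

lemma ex_strict_mono_enumeration:
  fixes M :: "'a::linorder set"
  assumes "finite M"
  obtains h where "strict_mono_on {1..card M} h" "h ` {1..card M} = M"
proof
  define xs where "xs = sorted_list_of_set M"
  have len: "length xs = card M" by (simp add: xs_def)
  show "strict_mono_on {1..card M} (\<lambda>i. xs ! (i - 1))"
  proof (rule strict_mono_onI)
    fix r s assume "r \<in> {1..card M}" "s \<in> {1..card M}" "r < s"
    then have "r - 1 < s - 1" "s - 1 < length xs" using len by auto
    then show "xs ! (r - 1) < xs ! (s - 1)"
      using sorted_wrt_nth_less[of "(<)" xs "r - 1" "s - 1"] by (simp add: xs_def)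
  qed
  have "(\<lambda>i. i - 1) ` {1..card M} = {0..<card M}"
    by (rule bij_betw_imp_surj_on, rule bij_betw_byWitness[where f' = Suc]) auto
  then have "(!) xs ` {0..<length xs} = (!) xs ` (\<lambda>i. i - 1) ` {1..card M}"
    by (simp only: len)
  also have "\<dots> = (\<lambda>i. xs ! (i - 1)) ` {1..card M}"
    by (rule image_image)
  also have "(!) xs ` {0..<length xs} = M"
    unfolding nth_image[OF le_refl] using assms by (simp add: xs_def)
  finally show "(\<lambda>i. xs ! (i - 1)) ` {1..card M} = M" ..
qed

text \<open>Each of the three tuples is the merged sequence read along a strictly increasing map of
  positions (\<open>\<rho>\<close> in \<open>gen\<close>), so order and range are inherited.\<close>

lemma config_entries_mono:
  assumes c: "(\<phi>, \<psi>, \<theta>) \<in> config_space m n" and n: "n \<ge> 1"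
  shows "strict_mono_on {1..m} \<phi>" "\<phi> ` {1..m} \<subseteq> {0..<2 * pi}"
    and "strict_mono_on {1..m} \<psi>" "\<psi> ` {1..m} \<subseteq> {0..<2 * pi}"
    and "strict_mono_on {1..2 * m * n} \<theta>" "\<theta> ` {1..2 * m * n} \<subseteq> {0..<2 * pi}"
proof -
  let ?X = "merged n (\<phi>, \<psi>, \<theta>)"
  have mono: "?X r < ?X s" if "r < s" "s < 2 * m * (n + 1)" for r s
    using config_space_mono(1)[OF c n] that by blast
  have range: "?X s \<in> {0..<2 * pi}" if "s < 2 * m * (n + 1)" for s
    using config_space_mono(2)[OF c n that] mono[of 0 s] that merged_0[OF c] by (cases "s = 0") auto
  have gen: "strict_mono_on A f \<and> f ` A \<subseteq> {0..<2 * pi}"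
    if "\<And>a. a \<in> A \<Longrightarrow> f a = ?X (\<rho> a)" "\<And>a. a \<in> A \<Longrightarrow> \<rho> a < 2 * m * (n + 1)" "strict_mono_on A \<rho>"
    for f \<rho> and A :: "nat set"
  proof
    show "strict_mono_on A f"
    proof (rule strict_mono_onI)
      fix r s assume "r \<in> A" "s \<in> A" "r < s"
      then show "f r < f s" using that(1,2) mono[of "\<rho> r" "\<rho> s"] strict_mono_onD[OF that(3)] by simp
    qed
    show "f ` A \<subseteq> {0..<2 * pi}" using that(1,2) range by fastforce
  qed
  have \<phi>: "strict_mono_on {1..m} \<phi> \<and> \<phi> ` {1..m} \<subseteq> {0..<2 * pi}"
  proof (rule gen)
    fix j assume j: "j \<in> {1..m}"
    then show "\<phi> j = ?X (2 * (j - 1) * (n + 1))" unfolding merged_wall by simp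
    show "2 * (j - 1) * (n + 1) < 2 * m * (n + 1)" using j block_index_bound'[of "2 * (j - 1)" "2 * m" 0 n] by auto
  next
    show "strict_mono_on {1..m} (\<lambda>j. 2 * (j - 1) * (n + 1))"
      unfolding strict_mono_on_def mult_less_cancel2 by auto
  qed
  have \<psi>: "strict_mono_on {1..m} \<psi> \<and> \<psi> ` {1..m} \<subseteq> {0..<2 * pi}"
  proof (rule gen)
    fix j assume j: "j \<in> {1..m}"
    then show "\<psi> j = ?X ((2 * (j - 1) + 1) * (n + 1))" unfolding merged_wall by simp
    show "(2 * (j - 1) + 1) * (n + 1) < 2 * m * (n + 1)"
      using j block_index_bound'[of "2 * (j - 1) + 1" "2 * m" 0 n] by auto
  next
    show "strict_mono_on {1..m} (\<lambda>j. (2 * (j - 1) + 1) * (n + 1))"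
      unfolding strict_mono_on_def mult_less_cancel2 by auto
  qed
  have \<theta>: "strict_mono_on {1..2 * m * n} \<theta> \<and> \<theta> ` {1..2 * m * n} \<subseteq> {0..<2 * pi}"
  proof (rule gen)
    fix k assume k: "k \<in> {1..2 * m * n}"
    then obtain b i where bi: "b < 2 * m" "i \<in> {1..n}" "k = b * n + i" by (rule block_index)
    have "k - 1 = (i - 1) + b * n" using bi by auto
    moreover have "(i - 1 + b * n) div n = b"
      using bi by (subst div_mult_self1) auto
    ultimately have "(k - 1) div n = b" by (simp only:)
    \<comment> \<open>Free point number \<open>k\<close> in block \<open>b\<close> stands at the
      zero-based position \<open>k + b\<close>, since \<open>k - 1\<close> free points and
      \<open>b + 1\<close> walls precede it.\<close>
    then have *: "k + (k - 1) div n = b * (n + 1) + i" using bi by (simp add: algebra_simps)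
    show "\<theta> k = ?X (k + (k - 1) div n)"
      using merged_inner(1)[of i n \<phi> \<psi> \<theta> b] bi unfolding * by (metis atLeastAtMost_iff less_eq_Suc_le One_nat_def)
    show "k + (k - 1) div n < 2 * m * (n + 1)" unfolding * using bi by (intro block_index_bound') auto
  next
    show "strict_mono_on {1..2 * m * n} (\<lambda>k. k + (k - 1) div n)"
      by (rule strict_mono_onI) (rule add_less_le_mono, assumption, rule div_le_mono, simp)
  qed
  show "strict_mono_on {1..m} \<phi>" "\<phi> ` {1..m} \<subseteq> {0..<2 * pi}"
    and "strict_mono_on {1..m} \<psi>" "\<psi> ` {1..m} \<subseteq> {0..<2 * pi}"
    and "strict_mono_on {1..2 * m * n} \<theta>" "\<theta> ` {1..2 * m * n} \<subseteq> {0..<2 * pi}"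
    using \<phi> \<psi> \<theta> by auto
qed

text \<open>\<open>cis\<close> is injective on [0, 2 pi), so equal sets of points have equal sets of
  angles, and a finite set has only one increasing enumeration.\<close>

lemma enumeration_unique_if_same_cis_image:
  fixes f g :: "nat \<Rightarrow> real"
  assumes "strict_mono_on {1..N} f" "f ` {1..N} \<subseteq> {0..<2 * pi}"
    "strict_mono_on {1..N} g" "g ` {1..N} \<subseteq> {0..<2 * pi}"
    "(\<lambda>j. cis (f j)) ` {1..N} = (\<lambda>j. cis (g j)) ` {1..N}" "j \<in> {1..N}"
  shows "f j = g j"
proof (rule strict_mono_same_image[OF assms(1,3) _ assms(6)])
  have inj: "inj_on cis {0..<2 * pi}" by (rule inj_onI) (auto intro: cis_inj_Ico)
  have "cis ` (f ` {1..N}) = cis ` (g ` {1..N})" using assms(5) by (simp add: image_image)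
  then show "f ` {1..N} = g ` {1..N}" using inj_on_image_eq_iff[OF inj assms(2,4)] by simp
qed

text \<open>\<open>jacobi_config\<close> prescribes only sets of points on the circle; the order
  built into \<open>config_space\<close> is what determines the tuples.\<close>

lemma jacobi_config_unique:
  assumes c: "jacobi_config m n p q c" and d: "jacobi_config m n p q d" and n: "n \<ge> 1"
  shows "c = d"
proof -
  obtain \<phi> \<psi> \<theta> where ceq: "c = (\<phi>, \<psi>, \<theta>)" by (cases c)
  obtain \<phi>' \<psi>' \<theta>' where deq: "d = (\<phi>', \<psi>', \<theta>')" by (cases d)
  have sp: "(\<phi>, \<psi>, \<theta>) \<in> config_space m n" "(\<phi>', \<psi>', \<theta>') \<in> config_space m n"
    using c d unfolding ceq deq jacobi_config_def by auto
  have im: "(\<lambda>j. cis (\<phi> j)) ` {1..m} = (\<lambda>j. cis (\<phi>' j)) ` {1..m}"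
    "(\<lambda>j. cis (\<psi> j)) ` {1..m} = (\<lambda>j. cis (\<psi>' j)) ` {1..m}"
    "(\<lambda>j. cis (\<theta> j)) ` {1..2 * m * n} = (\<lambda>j. cis (\<theta>' j)) ` {1..2 * m * n}"
    using c d unfolding ceq deq jacobi_config_def by auto
  note C = config_entries_mono[OF sp(1) n] and D = config_entries_mono[OF sp(2) n]
  have ext: "\<phi> \<in> extensional {1..m}" "\<phi>' \<in> extensional {1..m}" "\<psi> \<in> extensional {1..m}" "\<psi>' \<in> extensional {1..m}"
     "\<theta> \<in> extensional {1..2*m*n}" "\<theta>' \<in> extensional {1..2*m*n}"
    using sp unfolding config_space_def by (auto simp: PiE_def)
  have "\<phi> = \<phi>'"
    using ext(1,2) by (rule extensionalityI) (rule enumeration_unique_if_same_cis_image[OF C(1,2) D(1,2) im(1)])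
  moreover have "\<psi> = \<psi>'"
    using ext(3,4) by (rule extensionalityI) (rule enumeration_unique_if_same_cis_image[OF C(3,4) D(3,4) im(2)])
  moreover have "\<theta> = \<theta>'"
    using ext(5,6) by (rule extensionalityI) (rule enumeration_unique_if_same_cis_image[OF C(5,6) D(5,6) im(3)])
  ultimately show ?thesis unfolding ceq deq by simp
qed

section \<open>Roots on the circle and zeros of the circle polynomial\<close>

lemma power_eq_cis_set:
  assumes m: "m > 0"
  shows "{z. z ^ m = cis a} = (\<lambda>j. cis ((a + 2 * pi * real j) / real m)) ` {..<m}"
proof -
  have split: "cis ((a + 2 * pi * real j) / real m) = cis (a / real m) * cis (2 * pi * real j / real m)" for j
    by (simp add: cis_mult add_divide_distrib)
  have root: "cis (a / real m) ^ m = cis a" using m by (simp add: Complex.DeMoivre)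
  have roots: "(\<lambda>k. cis (2 * pi * real k / real m)) ` {..<m} = {z. z ^ m = 1}"
    using Complex.bij_betw_roots_unity[OF m] by (rule bij_betw_imp_surj_on)
  show ?thesis
  proof (intro equalityI subsetI)
    fix z assume "z \<in> {z. z ^ m = cis a}"
    then have "(z / cis (a / real m)) ^ m = 1" by (simp add: power_divide root)
    then obtain k where k: "k \<in> {..<m}" "z / cis (a / real m) = cis (2 * pi * real k / real m)"
      using roots by blast
    have "z = cis (a / real m) * cis (2 * pi * real k / real m)"
      unfolding k(2)[symmetric] by simp
    then show "z \<in> (\<lambda>j. cis ((a + 2 * pi * real j) / real m)) ` {..<m}"
      unfolding split using k(1) by (rule image_eqI)
  next
    fix z assume "z \<in> (\<lambda>j. cis ((a + 2 * pi * real j) / real m)) ` {..<m}"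
    then obtain k where k: "k < m" "z = cis (a / real m) * cis (2 * pi * real k / real m)"
      unfolding split by auto
    then have "cis (2 * pi * real k / real m) ^ m = 1" using roots by auto
    then show "z \<in> {z. z ^ m = cis a}" using k by (simp add: power_mult_distrib root)
  qed
qed

lemma map_poly_of_real_prod_linear:
  "map_poly complex_of_real (\<Prod>x\<in>S. [:- f x, 1:]) = (\<Prod>x\<in>S. [:- complex_of_real (f x), 1:])"
proof (induction S rule: infinite_finite_induct)
  case (insert x S)
  have "map_poly complex_of_real ([:- f x, 1:] * q) = [:- complex_of_real (f x), 1:] * map_poly complex_of_real q" for q
    by (rule poly_eqI) (simp add: coeff_map_poly coeff_pCons split: nat.split)
  then show ?case
    by (simp only: prod.insert[OF insert.hyps] insert.IH)
qed auto

text \<open>For w = z^m the product of \<open>w - cis t\<close> and \<open>w - cis (- t)\<close>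
  equals 2w (w/2 + 1/(2w) - cos t). Under this Joukowski map each zero cos t of \<open>P\<close>
  thus pulls back to the values \<open>cis t\<close> and \<open>cis (- t)\<close> of
  \<open>z ^ m\<close>.\<close>

lemma circle_poly_zeros:
  assumes m: "m > 0" and S: "finite S" "card S = n" and P: "P = smult c (\<Prod>x\<in>S. [:- cos x, 1:])" "c \<noteq> 0"
  shows "{z. poly (circle_poly m n P) z = 0} = (\<Union>t\<in>S. {z. z ^ m = cis t} \<union> {z. z ^ m = cis (- t)})"
proof -
  have deg: "degree P = n"
    using P S by (simp add: degree_prod_eq_sum_degree)
  have P_poly: "poly (map_poly complex_of_real P) w = complex_of_real c * (\<Prod>x\<in>S. w - complex_of_real (cos x))" for w
  proof -
    have "map_poly complex_of_real P = smult (of_real c) (map_poly complex_of_real (\<Prod>x\<in>S. [:- cos x, 1:]))"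
      unfolding P by (rule poly_eqI) (simp add: coeff_map_poly)
    then show ?thesis by (simp add: map_poly_of_real_prod_linear poly_prod)
  qed
  \<comment> \<open>The origin is outside the scope of \<open>poly_circle_poly\<close>. There only
    the term \<open>k = n\<close> survives, the leading coefficient of \<open>P\<close> divided by
    2^n.\<close>
  have zero: "poly (circle_poly m n P) 0 \<noteq> 0"
  proof -
    have "(0 :: complex) ^ (2 * m) = 0" using m by simp
    then have "poly (circle_poly m n P) 0 = (\<Sum>k\<le>n. if k = n then complex_of_real (coeff P n) * (1 / 2) ^ n else 0)"
      unfolding circle_poly_def poly_sum using m
      by (intro sum.cong) (auto simp: poly_monom zero_power)
    also have "\<dots> = complex_of_real (coeff P n) * (1 / 2) ^ n" by simp
    also have "coeff P n = lead_coeff P" by (simp add: deg)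
    finally show ?thesis using P S by (auto simp: lead_coeff_prod)
  qed
  have "poly (circle_poly m n P) z = 0 \<longleftrightarrow> (\<exists>t\<in>S. z ^ m = cis t \<or> z ^ m = cis (- t))" for z
  proof (cases "z = 0")
    case True
    then have "z ^ m = 0" using m by simp
    moreover have "cis t \<noteq> 0" for t by simp
    ultimately show ?thesis using True zero by metis
  next
    case False
    define w where "w = z ^ m"
    have w: "w \<noteq> 0" using False by (simp add: w_def)
    have "poly (circle_poly m n P) z = 0 \<longleftrightarrow> (\<exists>t\<in>S. w / 2 + 1 / (2 * w) - complex_of_real (cos t) = 0)"
    proof -
      have "poly (circle_poly m n P) z = z ^ (m * n) *
          (complex_of_real c * (\<Prod>t\<in>S. w / 2 + 1 / (2 * w) - complex_of_real (cos t)))"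
        using poly_circle_poly[of P n z m] deg False unfolding P_poly w_def by simp
      then show ?thesis using False P(2) S(1) by simp
    qed
    also have "\<dots> \<longleftrightarrow> (\<exists>t\<in>S. w = cis t \<or> w = cis (- t))"
    proof (rule bex_cong[OF refl])
      fix t
      have "cis t * cis (- t) = 1" "cis t + cis (- t) = 2 * complex_of_real (cos t)"
        by (simp_all add: cis_mult complex_eq_iff)
      moreover have "(w - cis t) * (w - cis (- t)) = w * w - w * (cis t + cis (- t)) + cis t * cis (- t)"
        by (simp only: algebra_simps)
      ultimately have "(w - cis t) * (w - cis (- t)) = w * w - w * (2 * complex_of_real (cos t)) + 1"
        by (simp only:)
      also have "\<dots> = 2 * w * (w / 2 + 1 / (2 * w) - complex_of_real (cos t))"
        using w by (simp add: field_simps)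
      finally show "w / 2 + 1 / (2 * w) - complex_of_real (cos t) = 0 \<longleftrightarrow> w = cis t \<or> w = cis (- t)"
        using w by (metis eq_iff_diff_eq_0 mult_eq_0_iff zero_neq_numeral)
    qed
    finally show ?thesis by (simp add: w_def)
  qed
  then show ?thesis by blast
qed

section \<open>The explicit equilibrium\<close>

text \<open>On the scale \<open>m * x\<close> and modulo 2 pi, the free points are the angles
  \<open>\<tau> i\<close> in even blocks and the mirror images \<open>2 * pi - \<tau> i\<close> in
  odd ones. The index \<open>n + 1 - i\<close> restores increasing order after the
  reflection.\<close>

definition canonical_config :: "nat \<Rightarrow> nat \<Rightarrow> (nat \<Rightarrow> real) \<Rightarrow> config" where
  "canonical_config m n \<tau> =
     (\<lambda>j\<in>{1..m}. 2 * pi * real (j - 1) / real m,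
      \<lambda>j\<in>{1..m}. (pi + 2 * pi * real (j - 1)) / real m,
      \<lambda>k\<in>{1..2 * m * n}.
        let b = (k - 1) div n; i = (k - 1) mod n + 1
        in if even b then (\<tau> i + pi * real b) / real m
           else (pi * real (b + 1) - \<tau> (n + 1 - i)) / real m)"

lemma canonical_theta:
  assumes "canonical_config m n \<tau> = (\<phi>, \<psi>, \<theta>)" "b < 2 * m" "i \<in> {1..n}"
  shows "\<theta> (b * n + i) = (if even b then (\<tau> i + pi * real b) / real m
           else (pi * real (b + 1) - \<tau> (n + 1 - i)) / real m)"
proof -
  have k: "b * n + i - 1 = i - 1 + b * n" using assms(3) by auto
  have "(b * n + i - 1) div n = b" unfolding k using assms(3) by (subst div_mult_self1) auto
  moreover have "(b * n + i - 1) mod n + 1 = i" unfolding k using assms(3) by (subst mod_mult_self1) auto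
  moreover have "b * n + i \<in> {1..2 * m * n}"
    using assms(3) block_index_bound[of b "2 * m" i n] assms(2) by auto
  moreover have "\<theta> = (\<lambda>k\<in>{1..2 * m * n}.
        let b = (k - 1) div n; i = (k - 1) mod n + 1
        in if even b then (\<tau> i + pi * real b) / real m
           else (pi * real (b + 1) - \<tau> (n + 1 - i)) / real m)"
    using assms(1) by (simp add: canonical_config_def)
  ultimately show ?thesis by (simp only: restrict_apply if_True Let_def)
qed

text \<open>The interaction has half angles, so rotations by \<open>2 * pi / m\<close> turn into the
  shifts by \<open>pi / m\<close> of \<open>sum_cot_shifted\<close>.\<close>

lemma sum_cot_rotations:
  assumes m: "m > 0"
  shows "(\<Sum>j<m. cot ((x - (a + 2 * pi * real j) / real m) / 2)) = real m * cot ((real m * x - a) / 2)"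
proof -
  define y where "y = - ((x - a / real m) / 2)"
  have "(\<Sum>j<m. cot ((x - (a + 2 * pi * real j) / real m) / 2)) = (\<Sum>j<m. - cot (y + pi * real j / real m))"
  proof (rule sum.cong[OF refl])
    fix j
    have "(x - (a + 2 * pi * real j) / real m) / 2 = - (y + pi * real j / real m)"
      by (simp add: y_def add_divide_distrib diff_divide_distrib)
    then show "cot ((x - (a + 2 * pi * real j) / real m) / 2) = - cot (y + pi * real j / real m)"
      by (simp only: cot_minus)
  qed
  also have "\<dots> = - (real m * cot (real m * y))"
    unfolding sum_negf sum_cot_shifted[OF m] ..
  also have "real m * y = - ((real m * x - a) / 2)"
    using m by (simp add: y_def field_simps)
  finally show ?thesis by (simp only: cot_minus mult_minus_right minus_minus)
qed

context
  fixes m n :: nat and p q :: real and \<tau> :: "nat \<Rightarrow> real"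
  assumes m: "m \<ge> 1" and n: "n \<ge> 1" and p: "p > 0" and q: "q > 0"
    and mono: "strict_mono_on {1..n} \<tau>" and range: "\<tau> ` {1..n} \<subseteq> {0<..<pi}"
    and zeros: "\<And>i. i \<in> {1..n} \<Longrightarrow> poly (jacobi_poly n (p - 1/2) (q - 1/2)) (cos (\<tau> i)) = 0"
begin

lemma tau_bounds: "i \<in> {1..n} \<Longrightarrow> 0 < \<tau> i" "i \<in> {1..n} \<Longrightarrow> \<tau> i < pi"
  using range by (auto simp: image_subset_iff)

lemma cos_tau_inj: "inj_on (\<lambda>i. cos (\<tau> i)) {1..n}"
proof (rule inj_onI)
  fix i j assume ij: "i \<in> {1..n}" "j \<in> {1..n}" "cos (\<tau> i) = cos (\<tau> j)"
  then have "\<tau> i = \<tau> j" using tau_bounds[OF ij(1)] tau_bounds[OF ij(2)] cos_inj_pi[of "\<tau> i" "\<tau> j"] by simp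
  then show "i = j" using strict_mono_on_imp_inj_on[OF mono] ij by (auto dest: inj_onD)
qed

text \<open>After multiplication by \<open>m\<close> and removal of multiples of pi, the required
  inequalities reduce to the chain 0 < \<tau>_1 < ... < \<tau>_n < pi.\<close>

lemma canonical_config_in_space: "canonical_config m n \<tau> \<in> config_space m n"
proof -
  obtain \<phi> \<psi> \<theta> where c: "canonical_config m n \<tau> = (\<phi>, \<psi>, \<theta>)" by (cases "canonical_config m n \<tau>")
  have \<phi>: "\<phi> j = 2 * pi * real (j - 1) / real m" if "j \<in> {1..m}" for j
    using c that by (auto simp: canonical_config_def)
  have \<psi>: "\<psi> j = (pi + 2 * pi * real (j - 1)) / real m" if "j \<in> {1..m}" for j
    using c that by (auto simp: canonical_config_def)
  have \<theta>1: "\<theta> (2 * (j - 1) * n + i) = (\<tau> i + 2 * pi * real (j - 1)) / real m"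
    if "j \<in> {1..m}" "i \<in> {1..n}" for i j
    using canonical_theta[OF c _ that(2), of "2 * (j - 1)"] that(1) by (auto simp: mult_ac)
  have \<theta>2: "\<theta> ((2 * j - 1) * n + i) = (2 * pi + 2 * pi * real (j - 1) - \<tau> (n + 1 - i)) / real m"
    if "j \<in> {1..m}" "i \<in> {1..n}" for i j
  proof -
    have "2 * j - 1 < 2 * m" "odd (2 * j - 1)" "real (2 * j - 1 + 1) = 2 + 2 * real (j - 1)"
      using that(1) by auto
    then show ?thesis using canonical_theta[OF c _ that(2), of "2 * j - 1"]
      by (simp only: if_False) (simp add: algebra_simps)
  qed
  have mp: "real m > 0" using m by simp
  have \<tau>: "\<tau> i < \<tau> (i + 1)" if "i \<in> {1..<n}" for i
    using strict_mono_onD[OF mono, of i "i + 1"] that by auto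
  have "\<phi> j < \<theta> (2*(j-1)*n + 1) \<and>
           (\<forall>i\<in>{1..<n}. \<theta> (2*(j-1)*n + i) < \<theta> (2*(j-1)*n + i + 1)) \<and>
           \<theta> ((2*j-1)*n) < \<psi> j \<and>
           \<psi> j < \<theta> ((2*j-1)*n + 1) \<and>
           (\<forall>i\<in>{1..<n}. \<theta> ((2*j-1)*n + i) < \<theta> ((2*j-1)*n + i + 1)) \<and>
           \<theta> (2*j*n) < (if j = m then 2 * pi else \<phi> (j+1))" if j: "j \<in> {1..m}" for j
  proof (intro conjI ballI)
    show "\<phi> j < \<theta> (2*(j-1)*n + 1)"
      unfolding \<phi>[OF j] using \<theta>1[OF j, of 1] tau_bounds[of 1] n mp by (simp add: divide_strict_right_mono)
    show "\<theta> (2*(j-1)*n + i) < \<theta> (2*(j-1)*n + i + 1)" if "i \<in> {1..<n}" for i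
      unfolding add.assoc using \<theta>1[OF j, of i] \<theta>1[OF j, of "i + 1"] that \<tau>[OF that] mp
      by (simp add: divide_strict_right_mono)
    have "(2*j-1)*n = 2*(j-1)*n + n" using j by (cases j) auto
    then show "\<theta> ((2*j-1)*n) < \<psi> j"
      unfolding \<psi>[OF j] using \<theta>1[OF j, of n] tau_bounds[of n] n mp by (simp add: divide_strict_right_mono)
    show "\<psi> j < \<theta> ((2*j-1)*n + 1)"
      unfolding \<psi>[OF j] using \<theta>2[OF j, of 1] tau_bounds[of n] n mp by (simp add: divide_strict_right_mono)
    show "\<theta> ((2*j-1)*n + i) < \<theta> ((2*j-1)*n + i + 1)" if "i \<in> {1..<n}" for i
    proof -
      have "\<tau> (n + 1 - (i + 1)) < \<tau> (n + 1 - i)"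
        using that by (intro strict_mono_onD[OF mono]) auto
      then show ?thesis
        unfolding add.assoc using \<theta>2[OF j, of i] \<theta>2[OF j, of "i + 1"] that mp
        by (simp add: divide_strict_right_mono)
    qed
    have "2*j*n = (2*j-1)*n + n" using j by (cases j) auto
    then have "\<theta> (2*j*n) < (2 * pi + 2 * pi * real (j - 1)) / real m"
      using \<theta>2[OF j, of n] tau_bounds[of 1] n mp by (simp add: divide_strict_right_mono)
    also have "\<dots> = 2 * pi * real j / real m"
      using j by (simp add: of_nat_diff algebra_simps)
    also have "\<dots> = (if j = m then 2 * pi else \<phi> (j+1))"
      using j mp \<phi>[of "j + 1"] by auto
    finally show "\<theta> (2*j*n) < (if j = m then 2 * pi else \<phi> (j+1))" .
  qed
  moreover have "\<phi> 1 = 0" using \<phi>[of 1] m by simp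
  moreover have "\<phi> \<in> {1..m} \<rightarrow>\<^sub>E UNIV" "\<psi> \<in> {1..m} \<rightarrow>\<^sub>E UNIV" "\<theta> \<in> {1..2*m*n} \<rightarrow>\<^sub>E UNIV"
    using c by (auto simp: canonical_config_def)
  ultimately show ?thesis unfolding c config_space_def by (simp only: mem_Collect_eq prod.case) simp
qed

lemma canonical_theta_image:
  fixes f :: "real \<Rightarrow> 'a"
  assumes c: "canonical_config m n \<tau> = (\<phi>, \<psi>, \<theta>)"
  shows "(\<lambda>k. f (\<theta> k)) ` {1..2 * m * n} =
    (\<Union>i\<in>{1..n}. (\<lambda>j. f ((\<tau> i + 2 * pi * real j) / real m)) ` {..<m} \<union>
       (\<lambda>j. f ((2 * pi - \<tau> i + 2 * pi * real j) / real m)) ` {..<m})"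
proof (intro equalityI subsetI)
  fix y assume "y \<in> (\<lambda>k. f (\<theta> k)) ` {1..2 * m * n}"
  then obtain k where k: "k \<in> {1..2 * m * n}" "y = f (\<theta> k)" by auto
  from k(1) obtain b i where bi: "b < 2 * m" "i \<in> {1..n}" "k = b * n + i" by (rule block_index)
  have j: "b div 2 < m" using bi by simp
  show "y \<in> (\<Union>i\<in>{1..n}. (\<lambda>j. f ((\<tau> i + 2 * pi * real j) / real m)) ` {..<m} \<union>
       (\<lambda>j. f ((2 * pi - \<tau> i + 2 * pi * real j) / real m)) ` {..<m})"
  proof (cases "even b")
    case True
    then have "real b = 2 * real (b div 2)" by auto
    then have "\<theta> k = (\<tau> i + 2 * pi * real (b div 2)) / real m"
      using canonical_theta[OF c bi(1,2)] True unfolding bi(3) by simp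
    then have "y \<in> (\<lambda>j. f ((\<tau> i + 2 * pi * real j) / real m)) ` {..<m}" using k(2) j by auto
    then show ?thesis using bi(2) by blast
  next
    case False
    then have "real (b + 1) = 2 + 2 * real (b div 2)" by (auto elim!: oddE)
    then have "\<theta> k = (2 * pi - \<tau> (n + 1 - i) + 2 * pi * real (b div 2)) / real m"
      using canonical_theta[OF c bi(1,2)] False unfolding bi(3)
      by (simp only: if_False) (simp add: algebra_simps)
    then have "y \<in> (\<lambda>j. f ((2 * pi - \<tau> (n + 1 - i) + 2 * pi * real j) / real m)) ` {..<m}"
      using k(2) j by auto
    moreover have "n + 1 - i \<in> {1..n}" using bi(2) by auto
    ultimately show ?thesis by blast
  qed
next
  fix y assume "y \<in> (\<Union>i\<in>{1..n}. (\<lambda>j. f ((\<tau> i + 2 * pi * real j) / real m)) ` {..<m} \<union>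
       (\<lambda>j. f ((2 * pi - \<tau> i + 2 * pi * real j) / real m)) ` {..<m})"
  then obtain i j where ij: "i \<in> {1..n}" "j < m"
      "y = f ((\<tau> i + 2 * pi * real j) / real m) \<or> y = f ((2 * pi - \<tau> i + 2 * pi * real j) / real m)"
    by auto
  have in_range: "b * n + i' \<in> {1..2 * m * n}" if "b < 2 * m" "i' \<in> {1..n}" for b i'
    using block_index_bound[OF that(1), of i' n] that(2) by auto
  from ij(3) show "y \<in> (\<lambda>k. f (\<theta> k)) ` {1..2 * m * n}"
  proof
    assume y: "y = f ((\<tau> i + 2 * pi * real j) / real m)"
    have "\<theta> (2 * j * n + i) = (\<tau> i + 2 * pi * real j) / real m"
      using canonical_theta[OF c _ ij(1), of "2 * j"] ij(2) by (simp add: mult_ac)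
    then have "y = f (\<theta> (2 * j * n + i))" by (simp only: y)
    then show ?thesis by (rule image_eqI) (use in_range[of "2 * j" i] ij in simp)
  next
    assume y: "y = f ((2 * pi - \<tau> i + 2 * pi * real j) / real m)"
    have i': "n + 1 - i \<in> {1..n}" "n + 1 - (n + 1 - i) = i" using ij(1) by auto
    have "\<theta> ((2 * j + 1) * n + (n + 1 - i)) = (2 * pi - \<tau> i + 2 * pi * real j) / real m"
      using canonical_theta[OF c _ i'(1), of "2 * j + 1"] ij(2) unfolding i'(2)
      by (simp add: distrib_left)
    then have "y = f (\<theta> ((2 * j + 1) * n + (n + 1 - i)))" by (simp only: y)
    then show ?thesis by (rule image_eqI) (use in_range[OF _ i'(1), of "2 * j + 1"] ij(2) in linarith)
  qed
qed

lemma canonical_config_jacobi: "jacobi_config m n p q (canonical_config m n \<tau>)"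
proof -
  obtain \<phi> \<psi> \<theta> where c: "canonical_config m n \<tau> = (\<phi>, \<psi>, \<theta>)" by (cases "canonical_config m n \<tau>")
  have m0: "m > 0" using m by simp
  have shift: "(\<lambda>j. h (j - 1)) ` {1..m} = h ` {..<m}" for h :: "nat \<Rightarrow> complex"
  proof -
    have "(\<lambda>j. j - 1) ` {1..m} = {..<m}"
      by (rule bij_betw_imp_surj_on, rule bij_betw_byWitness[where f' = Suc]) auto
    then show ?thesis by (metis image_image)
  qed
  have "(\<lambda>j. cis (\<phi> j)) ` {1..m} = (\<lambda>j. cis ((0 + 2 * pi * real (j - 1)) / real m)) ` {1..m}"
    using c by (intro image_cong) (auto simp: canonical_config_def)
  also have "\<dots> = {z. z ^ m = cis 0}"
    unfolding shift[of "\<lambda>j. cis ((0 + 2 * pi * real j) / real m)"] power_eq_cis_set[OF m0] ..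
  finally have \<phi>: "(\<lambda>j. cis (\<phi> j)) ` {1..m} = {z. z ^ m = 1}" by simp
  have "(\<lambda>j. cis (\<psi> j)) ` {1..m} = (\<lambda>j. cis ((pi + 2 * pi * real (j - 1)) / real m)) ` {1..m}"
    using c by (intro image_cong) (auto simp: canonical_config_def)
  also have "\<dots> = {z. z ^ m = cis pi}"
    unfolding shift[of "\<lambda>j. cis ((pi + 2 * pi * real j) / real m)"] power_eq_cis_set[OF m0] ..
  finally have \<psi>: "(\<lambda>j. cis (\<psi> j)) ` {1..m} = {z. z ^ m = -1}" by simp
  define S where "S = \<tau> ` {1..n}"
  have inj: "inj_on \<tau> {1..n}" by (rule strict_mono_on_imp_inj_on[OF mono])
  have S: "finite S" "card S = n" using card_image[OF inj] by (simp_all add: S_def)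
  define X where "X = (\<lambda>i. cos (\<tau> i)) ` {1..n}"
  have X: "finite X" "card X = n" "\<forall>x\<in>X. poly (jacobi_poly n (p - 1/2) (q - 1/2)) x = 0"
    using zeros card_image[OF cos_tau_inj] by (auto simp: X_def)
  obtain d where d: "d \<noteq> 0" "jacobi_poly n (p - 1/2) (q - 1/2) = smult d (\<Prod>x\<in>X. [:- x, 1:])"
    using jacobi_poly_factorisation[OF _ _ X] p q by auto
  have "(\<Prod>x\<in>X. [:- x, 1:]) = (\<Prod>t\<in>S. [:- cos t, 1:])"
    unfolding X_def S_def prod.reindex[OF cos_tau_inj] prod.reindex[OF inj] o_def ..
  then have "jacobi_poly n (p - 1/2) (q - 1/2) = smult d (\<Prod>t\<in>S. [:- cos t, 1:])" using d by simp
  note zs = circle_poly_zeros[OF m0 S this d(1)]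
  have per: "cis (2 * pi - t) = cis (- t)" for t by (simp add: complex_eq_iff)
  have "(\<lambda>j. cis (\<theta> j)) ` {1..2 * m * n} =
      (\<Union>i\<in>{1..n}. {z. z ^ m = cis (\<tau> i)} \<union> {z. z ^ m = cis (2 * pi - \<tau> i)})"
    unfolding canonical_theta_image[OF c, of cis] power_eq_cis_set[OF m0] ..
  also have "\<dots> = {z. poly (circle_poly m n (jacobi_poly n (p - 1/2) (q - 1/2))) z = 0}"
    unfolding zs per S_def by blast
  finally show ?thesis
    using canonical_config_in_space \<phi> \<psi> unfolding c jacobi_config_def by blast
qed

text \<open>\<open>G\<close> is the force field of the case \<open>m = 1\<close>: charge
  \<open>p\<close> at 0, charge \<open>q\<close> at pi and unit charges at \<plusminus>\<tau>_i. The
  angle \<open>x\<close> is arbitrary; if it is one of the points, its own term is 0 by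
  \<open>cot 0 = 0\<close>, and the sum is the force on that point.\<close>

lemma canonical_config_force:
  defines "G \<equiv> \<lambda>T. p * cot (T / 2) + q * cot ((T - pi) / 2) +
      (\<Sum>i=1..n. cot ((T - \<tau> i) / 2) + cot ((T + \<tau> i) / 2))"
  shows "(\<Sum>s<2 * m * (n + 1). charge n p q s * cot ((x - merged n (canonical_config m n \<tau>) s) / 2)) =
    real m * G (real m * x)"
proof -
  obtain \<phi> \<psi> \<theta> where c: "canonical_config m n \<tau> = (\<phi>, \<psi>, \<theta>)" by (cases "canonical_config m n \<tau>")
  have m0: "m > 0" using m by simp
  have shift: "(\<Sum>j=1..m. h (j - 1)) = (\<Sum>j<m. h j)" for h :: "nat \<Rightarrow> real"
    by (rule sum.reindex_bij_witness[of _ Suc "\<lambda>i. i - 1"]) auto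
  have "(\<Sum>j=1..m. cot ((x - \<phi> j) / 2)) = (\<Sum>j=1..m. cot ((x - (0 + 2 * pi * real (j - 1)) / real m) / 2))"
    using c by (intro sum.cong) (auto simp: canonical_config_def)
  also have "\<dots> = real m * cot ((real m * x - 0) / 2)"
    unfolding shift[of "\<lambda>j. cot ((x - (0 + 2 * pi * real j) / real m) / 2)"] by (rule sum_cot_rotations[OF m0])
  finally have \<phi>: "(\<Sum>j=1..m. cot ((x - \<phi> j) / 2)) = real m * cot (real m * x / 2)" by simp
  have "(\<Sum>j=1..m. cot ((x - \<psi> j) / 2)) = (\<Sum>j=1..m. cot ((x - (pi + 2 * pi * real (j - 1)) / real m) / 2))"
    using c by (intro sum.cong) (auto simp: canonical_config_def)
  also have "\<dots> = real m * cot ((real m * x - pi) / 2)"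
    unfolding shift[of "\<lambda>j. cot ((x - (pi + 2 * pi * real j) / real m) / 2)"] by (rule sum_cot_rotations[OF m0])
  finally have \<psi>: "(\<Sum>j=1..m. cot ((x - \<psi> j) / 2)) = real m * cot ((real m * x - pi) / 2)" .
  have even: "(\<Sum>j<m. \<Sum>i=1..n. cot ((x - \<theta> (2 * j * n + i)) / 2)) =
      (\<Sum>i=1..n. real m * cot ((real m * x - \<tau> i) / 2))"
  proof -
    have "(\<Sum>j<m. \<Sum>i=1..n. cot ((x - \<theta> (2 * j * n + i)) / 2)) =
        (\<Sum>j<m. \<Sum>i=1..n. cot ((x - (\<tau> i + 2 * pi * real j) / real m) / 2))"
    proof (intro sum.cong refl)
      fix j i assume "j \<in> {..<m}" "i \<in> {1..n}"
      then show "cot ((x - \<theta> (2 * j * n + i)) / 2) = cot ((x - (\<tau> i + 2 * pi * real j) / real m) / 2)"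
        using canonical_theta[OF c, of "2 * j" i] by (simp add: mult_ac)
    qed
    also have "\<dots> = (\<Sum>i=1..n. \<Sum>j<m. cot ((x - (\<tau> i + 2 * pi * real j) / real m) / 2))"
      by (rule sum.swap)
    finally show ?thesis unfolding sum_cot_rotations[OF m0] .
  qed
  have odd: "(\<Sum>j<m. \<Sum>i=1..n. cot ((x - \<theta> ((2 * j + 1) * n + i)) / 2)) =
      (\<Sum>i=1..n. real m * cot ((real m * x + \<tau> i) / 2))"
  proof -
    have "(\<Sum>j<m. \<Sum>i=1..n. cot ((x - \<theta> ((2 * j + 1) * n + i)) / 2)) =
        (\<Sum>j<m. \<Sum>i=1..n. cot ((x - (2 * pi - \<tau> (n + 1 - i) + 2 * pi * real j) / real m) / 2))"
    proof (intro sum.cong refl)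
      fix j i assume ji: "j \<in> {..<m}" "i \<in> {1..n}"
      have "\<theta> ((2 * j + 1) * n + i) = (2 * pi - \<tau> (n + 1 - i) + 2 * pi * real j) / real m"
        using canonical_theta[OF c _ ji(2), of "2 * j + 1"] ji(1) by (simp add: algebra_simps)
      then show "cot ((x - \<theta> ((2 * j + 1) * n + i)) / 2) =
          cot ((x - (2 * pi - \<tau> (n + 1 - i) + 2 * pi * real j) / real m) / 2)" by (simp only:)
    qed
    also have "\<dots> = (\<Sum>i=1..n. \<Sum>j<m. cot ((x - (2 * pi - \<tau> (n + 1 - i) + 2 * pi * real j) / real m) / 2))"
      by (rule sum.swap)
    also have "\<dots> = (\<Sum>i=1..n. real m * cot ((real m * x + \<tau> (n + 1 - i)) / 2))"
      unfolding sum_cot_rotations[OF m0]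
    proof (intro sum.cong refl)
      fix i
      \<comment> \<open>Replacing \<open>2 * pi - \<tau> (n + 1 - i)\<close> by its representative
        \<open>- \<tau> (n + 1 - i)\<close> shifts the half angle by pi, the period of
        \<open>cot\<close>.\<close>
      have "(real m * x + \<tau> (n + 1 - i)) / 2 = (real m * x - (2 * pi - \<tau> (n + 1 - i))) / 2 + pi"
        by (simp add: field_simps)
      then show "real m * cot ((real m * x - (2 * pi - \<tau> (n + 1 - i))) / 2) =
          real m * cot ((real m * x + \<tau> (n + 1 - i)) / 2)"
        by (simp only: cot_plus_pi)
    qed
    also have "\<dots> = (\<Sum>i=1..n. real m * cot ((real m * x + \<tau> i) / 2))"
      by (rule sum.reindex_bij_witness[of _ "\<lambda>i. n + 1 - i" "\<lambda>i. n + 1 - i"]) auto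
    finally show ?thesis .
  qed
  have \<theta>: "(\<Sum>k=1..2 * m * n. cot ((x - \<theta> k) / 2)) =
      (\<Sum>i=1..n. real m * cot ((real m * x - \<tau> i) / 2)) + (\<Sum>i=1..n. real m * cot ((real m * x + \<tau> i) / 2))"
    unfolding sum_upto_blocks sum_even_odd even odd ..
  have "(\<Sum>s<2 * m * (n + 1). charge n p q s * cot ((x - merged n (\<phi>, \<psi>, \<theta>) s) / 2)) =
      (\<Sum>j=1..m. p * cot ((x - \<phi> j) / 2)) + (\<Sum>j=1..m. q * cot ((x - \<psi> j) / 2)) +
      (\<Sum>k=1..2 * m * n. 1 * cot ((x - \<theta> k) / 2))"
    by (rule sum_merged)
  also have "\<dots> = p * (\<Sum>j=1..m. cot ((x - \<phi> j) / 2)) + q * (\<Sum>j=1..m. cot ((x - \<psi> j) / 2)) +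
      (\<Sum>k=1..2 * m * n. cot ((x - \<theta> k) / 2))"
    by (simp only: sum_distrib_left mult_1_left)
  also have "\<dots> = real m * G (real m * x)"
    unfolding \<phi> \<psi> \<theta> G_def
    by (simp only: distrib_left sum.distrib sum_distrib_left mult.left_commute[of _ "real m"] add.assoc)
  finally show ?thesis unfolding c .
qed

text \<open>Multiplied by \<open>sin \<tau>\<^sub>k\<close>, the force becomes the Jacobi differential equation evaluated at the
  zero \<open>cos \<tau>\<^sub>k\<close>.\<close>

lemma reduced_force_zero:
  assumes k: "k \<in> {1..n}"
  shows "p * cot (\<tau> k / 2) + q * cot ((\<tau> k - pi) / 2) +
      (\<Sum>i=1..n. cot ((\<tau> k - \<tau> i) / 2) + cot ((\<tau> k + \<tau> i) / 2)) = 0"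
proof -
  define t x where "t = \<tau> k" and "x = cos t"
  have t: "0 < t" "t < pi" using tau_bounds[OF k] by (auto simp: t_def)
  have sn: "sin t > 0" using t by (rule sin_gt_zero)
  have s2: "sin t * sin t = 1 - x\<^sup>2" unfolding x_def using sin_squared_eq[of t] by (simp add: power2_eq_square)
  define \<Sigma> where "\<Sigma> = (\<Sum>i\<in>{1..n} - {k}. 1 / (x - cos (\<tau> i)))"
  have ne: "cos t \<noteq> cos (\<tau> i)" if "i \<in> {1..n} - {k}" for i
    using inj_onD[OF cos_tau_inj, of k i] that k by (auto simp: t_def)
  have eq: "2 * (1 - x\<^sup>2) * \<Sigma> = (p - q) + (p + q + 1) * x"
  proof -
    define X where "X = (\<lambda>i. cos (\<tau> i)) ` {1..n}"
    have X: "finite X" "card X = n" "\<forall>x\<in>X. poly (jacobi_poly n (p - 1/2) (q - 1/2)) x = 0"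
      using zeros card_image[OF cos_tau_inj] by (auto simp: X_def)
    have "x \<in> X" using k by (auto simp: X_def x_def t_def)
    have "2 * (1 - x\<^sup>2) * (\<Sum>y\<in>X - {x}. 1 / (x - y)) + ((q - 1/2) - (p - 1/2) - ((p - 1/2) + (q - 1/2) + 2) * x) = 0"
      using jacobi_zeros_equilibrium[OF _ _ X \<open>x \<in> X\<close>] p q by simp
    moreover have "X - {x} = (\<lambda>i. cos (\<tau> i)) ` ({1..n} - {k})"
      unfolding X_def x_def t_def using inj_on_image_set_diff[OF cos_tau_inj, of "{1..n}" "{k}"] k by auto
    then have "(\<Sum>y\<in>X - {x}. 1 / (x - y)) = \<Sigma>"
      unfolding \<Sigma>_def by (simp add: sum.reindex[OF inj_on_subset[OF cos_tau_inj]])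
    ultimately show ?thesis by (simp add: algebra_simps)
  qed
  \<comment> \<open>In the term \<open>i = k\<close> the self-interaction is
    \<open>cot 0 = 0\<close>, while the point's own mirror image contributes
    \<open>cot t\<close>.\<close>
  have "(\<Sum>i=1..n. cot ((t - \<tau> i) / 2) + cot ((t + \<tau> i) / 2)) =
      cot t + (\<Sum>i\<in>{1..n} - {k}. cot ((t - \<tau> i) / 2) + cot ((t + \<tau> i) / 2))"
    using k by (subst sum.remove[of _ k]) (auto simp: t_def)
  also have "(\<Sum>i\<in>{1..n} - {k}. cot ((t - \<tau> i) / 2) + cot ((t + \<tau> i) / 2)) =
      (\<Sum>i\<in>{1..n} - {k}. - 2 * sin t * (1 / (x - cos (\<tau> i))))"
  proof (rule sum.cong[OF refl])
    fix i assume "i \<in> {1..n} - {k}"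
    then have "cos (\<tau> i) - cos t \<noteq> 0" using ne[of i] by auto
    then show "cot ((t - \<tau> i) / 2) + cot ((t + \<tau> i) / 2) = - 2 * sin t * (1 / (x - cos (\<tau> i)))"
      using cot_half_diff_add[of t "\<tau> i"] by (simp add: x_def field_simps)
  qed
  also have "\<dots> = - 2 * sin t * \<Sigma>" unfolding \<Sigma>_def sum_distrib_left ..
  finally have sum: "(\<Sum>i=1..n. cot ((t - \<tau> i) / 2) + cot ((t + \<tau> i) / 2)) = cot t - 2 * sin t * \<Sigma>"
    by simp
  have "(p * cot (t / 2) + q * cot ((t - pi) / 2) + (cot t - 2 * sin t * \<Sigma>)) * sin t =
      p * (cot (t / 2) * sin t) + q * (cot ((t - pi) / 2) * sin t) + cot t * sin t - 2 * (sin t * sin t) * \<Sigma>"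
    by (simp add: algebra_simps)
  also have "cot t * sin t = x" using sn by (simp add: cot_def x_def)
  also have "cot (t / 2) * sin t = 1 + x"
    using cot_half_mult_sin(1)[of t] sn by (auto simp: x_def)
  also have "cot ((t - pi) / 2) * sin t = - (1 - x)"
    using cot_half_mult_sin(2)[of t] sn by (auto simp: x_def)
  \<comment> \<open>The wall terms add up to p - q + (p + q) x; the mirror term \<open>x\<close>
    completes this to the right-hand side of \<open>eq\<close>.\<close>
  also have "p * (1 + x) + q * - (1 - x) + x - 2 * (sin t * sin t) * \<Sigma> = 0"
    unfolding s2 eq by (simp add: algebra_simps)
  finally show ?thesis using sn sum unfolding t_def[symmetric] by simp
qed

text \<open>Times \<open>m\<close>, each position is 0, pi, \<tau>_i or 2 pi - \<tau>_i up to a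
  multiple of 2 pi. Oddness and period give G(pi) = G(-pi) = -G(pi), and they carry the zero at
  \<tau>_i over to its mirror image.\<close>

lemma canonical_config_equilibrium:
  assumes r: "r < 2 * m * (n + 1)"
  defines "c \<equiv> canonical_config m n \<tau>"
  shows "(\<Sum>s<2 * m * (n + 1). charge n p q s * cot ((merged n c r - merged n c s) / 2)) = 0"
proof -
  define G where "G T = p * cot (T / 2) + q * cot ((T - pi) / 2) +
      (\<Sum>i=1..n. cot ((T - \<tau> i) / 2) + cot ((T + \<tau> i) / 2))" for T
  have G_odd: "G (- T) = - G T" for T
  proof -
    have a: "cot (- T / 2) = - cot (T / 2)" by simp
    have "(- T - pi) / 2 = - ((T - pi) / 2 + pi)" by (simp add: field_simps)
    then have b: "cot ((- T - pi) / 2) = - cot ((T - pi) / 2)" by (simp only: cot_minus cot_plus_pi)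
    have c: "cot ((- T - \<tau> i) / 2) + cot ((- T + \<tau> i) / 2) = - (cot ((T - \<tau> i) / 2) + cot ((T + \<tau> i) / 2))" for i
    proof -
      have "(- T - \<tau> i) / 2 = - ((T + \<tau> i) / 2)" "(- T + \<tau> i) / 2 = - ((T - \<tau> i) / 2)"
        by (simp_all add: field_simps)
      then show ?thesis by (simp only: cot_minus)
    qed
    show ?thesis unfolding G_def a b c sum_negf by simp
  qed
  have G_per: "G (T + 2 * pi * real j) = G T" for T j
  proof -
    have "(T + 2 * pi * real j + y) / 2 = (T + y) / 2 + real j * pi" for y by (simp add: field_simps)
    then have *: "cot ((T + 2 * pi * real j + y) / 2) = cot ((T + y) / 2)" for y by (simp only: cot_plus_nat_pi)
    have 0: "cot ((T + 2 * pi * real j) / 2) = cot (T / 2)" using *[of 0] by simp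
    have minus: "cot ((T + 2 * pi * real j - y) / 2) = cot ((T - y) / 2)" for y using *[of "- y"] by simp
    show ?thesis unfolding G_def 0 * minus ..
  qed
  have G0: "G 0 = 0" using G_odd[of 0] by simp
  have Gpi: "G pi = 0" using G_odd[of pi] G_per[of "- pi" 1] by simp
  have G\<tau>: "G (\<tau> i) = 0" if "i \<in> {1..n}" for i
    using reduced_force_zero[OF that] by (simp add: G_def)
  have G\<tau>': "G (2 * pi - \<tau> i) = 0" if "i \<in> {1..n}" for i
    using G_per[of "- \<tau> i" 1] G_odd[of "\<tau> i"] G\<tau>[OF that] by simp
  obtain \<phi> \<psi> \<theta> where ceq: "c = (\<phi>, \<psi>, \<theta>)" by (cases c)
  have mp: "real m > 0" using m by simp
  define b i where "b = r div (n + 1)" and "i = r mod (n + 1)"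
  have req: "r = b * (n + 1) + i" unfolding b_def i_def by (rule div_mult_mod_eq[symmetric])
  have i: "i \<le> n" unfolding i_def using mod_less_divisor[of "n + 1" r] by simp
  have b: "b < 2 * m" using r unfolding b_def by (simp only: less_mult_imp_div_less)
  define j where "j = b div 2"
  have j: "j < m" "j + 1 \<in> {1..m}" using b by (auto simp: j_def)
  have "\<exists>T. real m * merged n c r = T + 2 * pi * real j \<and> G T = 0"
  proof (cases "i = 0")
    case True
    then have "r = b * (n + 1)" by (simp add: req)
    then have "merged n c r = (if even b then \<phi> (j + 1) else \<psi> (j + 1))"
      unfolding ceq j_def by (simp only: merged_wall)
    also have "\<dots> = (if even b then 2 * pi * real j / real m else (pi + 2 * pi * real j) / real m)"
      using ceq j unfolding c_def canonical_config_def by auto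
    finally have "real m * merged n c r = (if even b then 0 else pi) + 2 * pi * real j"
      using mp by simp
    then show ?thesis using G0 Gpi by (cases "even b") (metis, metis)
  next
    case False
    then have i': "i \<in> {1..n}" "n + 1 - i \<in> {1..n}" using i by auto
    have M: "merged n c r = \<theta> (b * n + i)" unfolding ceq req using i' by (intro merged_inner) auto
    show ?thesis
    proof (cases "even b")
      case True
      then have "real b = 2 * real j" by (auto simp: j_def)
      then have "real m * merged n c r = \<tau> i + 2 * pi * real j"
        unfolding M using canonical_theta[OF ceq[unfolded c_def] b i'(1)] True mp by simp
      then show ?thesis using G\<tau>[OF i'(1)] by blast
    next
      case False
      then have "real (b + 1) = 2 + 2 * real j" by (auto simp: j_def elim!: oddE)
      then have "real m * merged n c r = pi * (2 + 2 * real j) - \<tau> (n + 1 - i)"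
        unfolding M using canonical_theta[OF ceq[unfolded c_def] b i'(1)] False mp by (simp only: if_False) simp
      also have "\<dots> = (2 * pi - \<tau> (n + 1 - i)) + 2 * pi * real j"
        by (simp add: algebra_simps)
      finally show ?thesis using G\<tau>'[OF i'(2)] by blast
    qed
  qed
  then obtain T where "real m * merged n c r = T + 2 * pi * real j" "G T = 0" by blast
  then have "G (real m * merged n c r) = 0" using G_per by simp
  then show ?thesis unfolding c_def canonical_config_force G_def by simp
qed

end

section \<open>Existence of the angles and conclusion\<close>

lemma ex_jacobi_angles:
  assumes "p > 0" "q > 0"
  shows "\<exists>\<tau>. strict_mono_on {1..n} \<tau> \<and> \<tau> ` {1..n} \<subseteq> {0<..<pi} \<and>
     (\<forall>i\<in>{1..n}. poly (jacobi_poly n (p - 1/2) (q - 1/2)) (cos (\<tau> i)) = 0)"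
proof -
  obtain S where S: "finite S" "card S = n" "S \<subseteq> {-1<..<1}"
      "\<forall>x\<in>S. poly (jacobi_poly n (p - 1/2) (q - 1/2)) x = 0"
    using jacobi_poly_zeros[of "p - 1/2" "q - 1/2" n] assms by auto
  have "inj_on arccos S"
    by (rule inj_on_inverseI[of _ cos]) (use S(3) in fastforce)
  then have card: "card (arccos ` S) = n" using S by (simp add: card_image)
  obtain \<tau> where \<tau>: "strict_mono_on {1..n} \<tau>" "\<tau> ` {1..n} = arccos ` S"
    using ex_strict_mono_enumeration[of "arccos ` S"] S(1) card by auto
  have arccos: "0 < arccos x \<and> arccos x < pi \<and> cos (arccos x) = x" if "x \<in> S" for x
    using that S(3) arccos_lt_bounded[of x] by auto
  have preimage: "\<exists>x\<in>S. \<tau> i = arccos x" if "i \<in> {1..n}" for i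
    using \<tau>(2) that by blast
  have "0 < \<tau> i \<and> \<tau> i < pi \<and> poly (jacobi_poly n (p - 1/2) (q - 1/2)) (cos (\<tau> i)) = 0"
    if "i \<in> {1..n}" for i
    using preimage[OF that] arccos S(4) by metis
  then show ?thesis using \<tau>(1) by (intro exI[of _ \<tau>] conjI) auto
qed

theorem theorem1:
  fixes m n :: nat and p q :: real
  assumes "m \<ge> 1" and "n \<ge> 1" and "p > 0" and "q > 0"
  shows "(\<exists>!c. jacobi_config m n p q c) \<and>
         (\<forall>c. is_arg_max (hamiltonian m n p q) (\<lambda>c. c \<in> config_space m n) c
                \<longleftrightarrow> jacobi_config m n p q c)"
proof -
  obtain \<tau> where \<tau>: "strict_mono_on {1..n} \<tau>" "\<tau> ` {1..n} \<subseteq> {0<..<pi}"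
     "\<And>i. i \<in> {1..n} \<Longrightarrow> poly (jacobi_poly n (p - 1/2) (q - 1/2)) (cos (\<tau> i)) = 0"
    using ex_jacobi_angles[OF assms(3,4), of n] by auto
  define c where "c = canonical_config m n \<tau>"
  have jc: "jacobi_config m n p q c"
    unfolding c_def by (rule canonical_config_jacobi[OF assms \<tau>])
  have c: "c \<in> config_space m n"
    unfolding c_def by (rule canonical_config_in_space[OF assms \<tau>])
  \<comment> \<open>A strict inequality against every other configuration gives existence and
    uniqueness of the maximiser at once, so no compactness argument enters for the non-closed
    space.\<close>
  have max: "hamiltonian m n p q d < hamiltonian m n p q c" if "d \<in> config_space m n" "d \<noteq> c" for d
    using equilibrium_unique_max[OF c that(1) assms(2,1,3,4) _ that(2)]
      canonical_config_equilibrium[OF assms \<tau>] unfolding c_def by blast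
  \<comment> \<open>This justifies the definite article in the claim: the conditions on the three
    point sets single out one configuration.\<close>
  have jacobi_iff: "jacobi_config m n p q d \<longleftrightarrow> d = c" for d
    using jc jacobi_config_unique[OF _ jc assms(2)] by blast
  have "is_arg_max (hamiltonian m n p q) (\<lambda>c. c \<in> config_space m n) d \<longleftrightarrow> d = c" for d
    unfolding is_arg_max_def using c max[of d] max less_asym by blast
  then show ?thesis using jacobi_iff by auto
qed

end
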